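(* Let $s\ge 1$ be an integer, let $\mathcal{D}=[a_1,b_1]\times\cdots\times[a_s,b_s]\subset\mathbb{R}^s$ with $a_j<b_j$ for all $j$, let $N\ge 2$ be an integer, let ${\bf g}=(g_1,\ldots,g_s)\in\{1,\ldots,N-1\}^s$, let $\alpha>1/2$ and $\boldsymbol{\gamma}=(\gamma_1,\ldots,\gamma_s)\in(\mathbb{R}^+)^s$. Let $\mathfrak{f}:\mathbb{R}^s\to\mathbb{R}$ be any function in $\mathcal{H}_{\mathcal{K}^{\cos}_{\alpha,\boldsymbol{\gamma},s}(\mathcal{D})}$, i.e. $\|\mathfrak{f}\|_{\mathcal{K}^{\cos}_{\alpha,\boldsymbol{\gamma},s}(\mathcal{D})}<\infty$, and let $\mu$ be any probability measure on $\mathbb{R}^s$ such that, for some real number $\beta>s$ and some vector $\boldsymbol{\rho}=(\rho_1,\ldots,\rho_s)\in(\mathbb{R}^+)^s$, $$\left(\int_{\mathbb{R}^s}\prod_{j=1}^s\cos\left(\pi k_j\frac{y_j-a_j}{b_j-a_j}\right)\mu(d{\bf y})\right)^2\le r_{\beta,\boldsymbol{\rho},s}({\bf k})\qquad\text{for all }{\bf k}=(k_1,\ldots,k_s)\in\mathbb{Z}^s.$$ Assume furthermore that $\beta-\alpha>1/2$. Then $$\left|\int_{\mathbb{R}^s}\frac1N\sum_{n=0}^{N-1}\bar{\mathfrak{f}}({\bf p}_{\boldsymbol{\phi},n})\,\mathcal{K}^{\cos}_s({\bf p}_{\boldsymbol{\phi},n},{\bf y})\,\mu(d{\bf y})-\int_{\mathbb{R}^s}\bar{\mathfrak{f}}({\bf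 y})\,\mu(d{\bf y})\right|\le\left(\sum_{{\bf h}\in L^\bot\setminus\{{\bf 0}\}}r_{\alpha,\boldsymbol{\gamma},s}({\bf h})\right)^{1/2}\left(\prod_{i=1}^sC_i\right)^{1/2}\|\mathfrak{f}\|_{\mathcal{K}^{\cos}_{\alpha,\boldsymbol{\gamma},s}(\mathcal{D})}$$ for some constants $C_1,\ldots,C_s$, where each $C_i$ depends only on $\alpha,\beta,\gamma_i,\rho_i$ (in particular not on $\mathfrak{f}$, $\mu$, $N$ or ${\bf g}$), and where $L^\bot:=\{{\bf h}\in\mathbb{Z}^s:{\bf h}\cdot{\bf g}\equiv 0\ (\bmod\ N)\}$ is the dual lattice.
   Context: Notation: $\mathbb{N}=\{0,1,2,\ldots\}$, $\mathbb{R}^+=(0,\infty)$, ${\bf a}=(a_1,\ldots,a_s)$, ${\bf b}=(b_1,\ldots,b_s)$; $\times$ and $/$ between vectors act component-wise. For an integer vector ${\bf k}$, $|{\bf k}|_0:=\#\{j:k_j\ne0\}$. $\{\cdot\}$ applied to a real vector denotes the component-wise fractional part. The function $r$: for real $\alpha>1/2$, $\gamma>0$, $k\in\mathbb{Z}$, set $r_{\alpha,\gamma}(0)=1$ and $r_{\alpha,\gamma}(k)=\gamma|k|^{-2\alpha}$ if $k\neq0$; for ${\bf k}\in\mathbb{Z}^s$ and $\boldsymbol{\gamma}\in(\mathbb{R}^+)^s$, $r_{\alpha,\boldsymbol{\gamma},s}({\bf k})=\prod_{j=1}^sr_{\alpha,\gamma_j}(k_j)$. (The function $r_{\beta,\boldsymbol{\rho},s}$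 is the same with $\beta,\boldsymbol{\rho}$ in place of $\alpha,\boldsymbol{\gamma}$.) Cosine coefficients: for $\mathfrak{f}:\mathbb{R}^s\to\mathbb{R}$ (integrable on $\mathcal{D}$), $$\widetilde{\mathfrak{f}}_{\cos}({\bf k}):=\int_{[0,1]^s}\mathfrak{f}({\bf y}\times({\bf b}-{\bf a})+{\bf a})\,2^{|{\bf k}|_0/2}\prod_{j=1}^s\cos(\pi k_jy_j)\,d{\bf y}.$$ Half-period cosine space: $\|\mathfrak{f}\|^2_{\mathcal{K}^{\cos}_{\alpha,\boldsymbol{\gamma},s}(\mathcal{D})}:=\sum_{{\bf k}\in\mathbb{N}^s}|\widetilde{\mathfrak{f}}_{\cos}({\bf k})|^2/r_{\alpha,\boldsymbol{\gamma},s}({\bf k})$, and $\mathfrak{f}\in\mathcal{H}_{\mathcal{K}^{\cos}_{\alpha,\boldsymbol{\gamma},s}(\mathcal{D})}$ means this quantity is finite. Half-period cosine expansion: $\bar{\mathfrak{f}}:\mathbb{R}^s\to\mathbb{R}$, $$\bar{\mathfrak{f}}({\bf y}):=\sum_{{\bf k}\in\mathbb{N}^s}\widetilde{\mathfrak{f}}_{\cos}({\bf k})(\sqrt2)^{|{\bf k}|_0}\prod_{j=1}^s\cos\left(\pi k_j\frac{y_j-a_j}{b_j-a_j}\right).$$ Tent-transformed lattice points: the tent transformation is $\phi:[0,1]\to[0,1]$, $\phi(x)=1-|2x-1|$, and $\boldsymbol{\phi}$ is its component-wise application on $[0,1]^s$. For $0\le n<N$, $${\bf p}_{\boldsymbol{\phi},n}:=\boldsymbol{\phi}\left(\left\{\frac{n{\bf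 g}}N\right\}\right)\times({\bf b}-{\bf a})+{\bf a}\in\mathcal{D}.$$ Kernel (without the $r$ factor), for ${\bf x},{\bf y}\in\mathbb{R}^s$: $$\mathcal{K}^{\cos}_s({\bf x},{\bf y}):=\prod_{j=1}^s\left(\sum_{k_j\in\mathbb{Z}}\cos\left(\pi k_j\frac{x_j-a_j}{b_j-a_j}\right)e^{\imath\pi k_j\frac{y_j-a_j}{b_j-a_j}}\right)=\sum_{{\bf k}\in\mathbb{Z}^s}\left(\prod_{j=1}^s\cos\left(\pi k_j\frac{x_j-a_j}{b_j-a_j}\right)\right)e^{\imath\pi{\bf k}\cdot\frac{{\bf y}-{\bf a}}{{\bf b}-{\bf a}}}.$$ Convention: this series is formal. All integrals are assumed finite and orders of summation and integration are exchanged freely, so an integral of the kernel against $\mu$ means the term-by-term integral, with the terms $\pm k_j$ grouped together in each coordinate; that is, $$\int_{\mathbb{R}^s}\mathcal{K}^{\cos}_s({\bf x},{\bf y})\,\mu(d{\bf y}):=\sum_{{\bf k}\in\mathbb{Z}^s}\left(\prod_{j=1}^s\cos\left(\pi k_j\frac{x_j-a_j}{b_j-a_j}\right)\right)\int_{\mathbb{R}^s}\prod_{j=1}^s\cos\left(\pi k_j\frac{y_j-a_j}{b_j-a_j}\right)\mu(d{\bf y}).$$ *)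

theory Defs
  imports "HOL-Probability.Probability" "HOL-Number_Theory.Cong"
begin

text \<open>
  Since the constants of the theorem must not depend on the dimension \<open>s\<close>, \<open>s\<close> is a variable
  and not a type: a vector with \<open>s\<close> components is a function on \<^typ>\<open>nat\<close>, read on the indices
  \<open>0, \<dots>, s - 1\<close>.  Vectors that range over a set (arguments of functions on the real \<open>s\<close>-space,
  points of integration, summation indices) are extensional, i.e. \<^const>\<open>undefined\<close> outside
  \<open>{..<s}\<close>, so that each of them occurs exactly once.
\<close>

definition int_vecs :: "nat \<Rightarrow> (nat \<Rightarrow> int) set" where
  "int_vecs s = (\<Pi>\<^sub>E j\<in>{..<s}. UNIV)"

definition nat_vecs :: "nat \<Rightarrow> (nat \<Rightarrow> int) set" where
  "nat_vecs s = (\<Pi>\<^sub>E j\<in>{..<s}. {0..})"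

definition zero_vec :: "nat \<Rightarrow> nat \<Rightarrow> int" where
  "zero_vec s = (\<lambda>j\<in>{..<s}. 0)"

definition cuboid :: "nat \<Rightarrow> (nat \<Rightarrow> real) \<Rightarrow> (nat \<Rightarrow> real) \<Rightarrow> (nat \<Rightarrow> real) set" where
  "cuboid s a b = (\<Pi>\<^sub>E j\<in>{..<s}. {a j..b j})"

definition borel_vec :: "nat \<Rightarrow> (nat \<Rightarrow> real) measure" where
  "borel_vec s = (\<Pi>\<^sub>M j\<in>{..<s}. borel)"

text \<open>The completion makes this \<open>s\<close>-dimensional Lebesgue, not just Borel, measure.\<close>

definition lebesgue_vec :: "nat \<Rightarrow> (nat \<Rightarrow> real) measure" where
  "lebesgue_vec s = completion (\<Pi>\<^sub>M j\<in>{..<s}. lborel)"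

definition num_nonzero :: "nat \<Rightarrow> (nat \<Rightarrow> int) \<Rightarrow> nat" where
  "num_nonzero s k = card {j. j < s \<and> k j \<noteq> 0}"

definition r1 :: "real \<Rightarrow> real \<Rightarrow> int \<Rightarrow> real" where
  "r1 \<alpha> \<gamma> k = (if k = 0 then 1 else \<gamma> * \<bar>real_of_int k\<bar> powr (- 2 * \<alpha>))"

definition r :: "nat \<Rightarrow> real \<Rightarrow> (nat \<Rightarrow> real) \<Rightarrow> (nat \<Rightarrow> int) \<Rightarrow> real" where
  "r s \<alpha> \<gamma> k = (\<Prod>j<s. r1 \<alpha> (\<gamma> j) (k j))"

definition scale_to :: "nat \<Rightarrow> (nat \<Rightarrow> real) \<Rightarrow> (nat \<Rightarrow> real) \<Rightarrow> (nat \<Rightarrow> real) \<Rightarrow> nat \<Rightarrow> real" where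
  "scale_to s a b y = (\<lambda>j\<in>{..<s}. y j * (b j - a j) + a j)"

definition cos_coeff ::
    "nat \<Rightarrow> (nat \<Rightarrow> real) \<Rightarrow> (nat \<Rightarrow> real) \<Rightarrow> ((nat \<Rightarrow> real) \<Rightarrow> real) \<Rightarrow> (nat \<Rightarrow> int) \<Rightarrow> real" where
  "cos_coeff s a b f k =
     (LINT y : cuboid s (\<lambda>_. 0) (\<lambda>_. 1) | lebesgue_vec s.
        f (scale_to s a b y) * 2 powr (real (num_nonzero s k) / 2) *
        (\<Prod>j<s. cos (pi * real_of_int (k j) * y j)))"

text \<open>The half-period cosine space: integrable on the cuboid and of finite norm.  The summands
  are nonnegative, so summability is finiteness of the series.\<close>

definition cos_space ::
    "nat \<Rightarrow> (nat \<Rightarrow> real) \<Rightarrow> (nat \<Rightarrow> real) \<Rightarrow> real \<Rightarrow> (nat \<Rightarrow> real) \<Rightarrow> ((nat \<Rightarrow> real) \<Rightarrow> real) set" where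
  "cos_space s a b \<alpha> \<gamma> =
     {f. set_integrable (lebesgue_vec s) (cuboid s a b) f \<and>
         (\<lambda>k. \<bar>cos_coeff s a b f k\<bar>\<^sup>2 / r s \<alpha> \<gamma> k) summable_on nat_vecs s}"

definition cos_norm ::
    "nat \<Rightarrow> (nat \<Rightarrow> real) \<Rightarrow> (nat \<Rightarrow> real) \<Rightarrow> real \<Rightarrow> (nat \<Rightarrow> real) \<Rightarrow> ((nat \<Rightarrow> real) \<Rightarrow> real) \<Rightarrow> real" where
  "cos_norm s a b \<alpha> \<gamma> f =
     sqrt (\<Sum>\<^sub>\<infinity>k\<in>nat_vecs s. \<bar>cos_coeff s a b f k\<bar>\<^sup>2 / r s \<alpha> \<gamma> k)"

definition cos_prod ::
    "nat \<Rightarrow> (nat \<Rightarrow> real) \<Rightarrow> (nat \<Rightarrow> real) \<Rightarrow> (nat \<Rightarrow> int) \<Rightarrow> (nat \<Rightarrow> real) \<Rightarrow> real" where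
  "cos_prod s a b k y = (\<Prod>j<s. cos (pi * real_of_int (k j) * ((y j - a j) / (b j - a j))))"

definition cos_expansion ::
    "nat \<Rightarrow> (nat \<Rightarrow> real) \<Rightarrow> (nat \<Rightarrow> real) \<Rightarrow> ((nat \<Rightarrow> real) \<Rightarrow> real) \<Rightarrow> (nat \<Rightarrow> real) \<Rightarrow> real" where
  "cos_expansion s a b f y =
     (\<Sum>\<^sub>\<infinity>k\<in>nat_vecs s. cos_coeff s a b f k * sqrt 2 ^ num_nonzero s k * cos_prod s a b k y)"

definition tent :: "real \<Rightarrow> real" where
  "tent x = 1 - \<bar>2 * x - 1\<bar>"

definition tent_point ::
    "nat \<Rightarrow> (nat \<Rightarrow> real) \<Rightarrow> (nat \<Rightarrow> real) \<Rightarrow> nat \<Rightarrow> (nat \<Rightarrow> nat) \<Rightarrow> nat \<Rightarrow> nat \<Rightarrow> real" where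
  "tent_point s a b N g n =
     scale_to s a b (\<lambda>j\<in>{..<s}. tent (frac (real n * real (g j) / real N)))"

text \<open>
  The cosine kernel is a formal series that need not converge pointwise, so it is not defined as a
  function; its integral against \<open>\<mu>\<close> in the second argument is, by convention, the series of
  the termwise integrals.  Grouping the terms with \<open>k\<^sub>j\<close> and \<open>- k\<^sub>j\<close> in each coordinate turns the
  exponential factors into cosines.
\<close>

definition kernel_integral ::
    "nat \<Rightarrow> (nat \<Rightarrow> real) \<Rightarrow> (nat \<Rightarrow> real) \<Rightarrow> (nat \<Rightarrow> real) measure \<Rightarrow> (nat \<Rightarrow> real) \<Rightarrow> real" where
  "kernel_integral s a b \<mu> x =
     (\<Sum>\<^sub>\<infinity>k\<in>int_vecs s. cos_prod s a b k x * (LINT y|\<mu>. cos_prod s a b k y))"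

text \<open>The integral against \<open>\<mu>\<close> of the average over \<open>n < N\<close> of \<open>f\<close>-expansion times kernel at
  the tent-transformed lattice points; being termwise in the kernel, it is the average of the
  kernel integrals.\<close>

definition lattice_kernel_integral ::
    "nat \<Rightarrow> (nat \<Rightarrow> real) \<Rightarrow> (nat \<Rightarrow> real) \<Rightarrow> nat \<Rightarrow> (nat \<Rightarrow> nat) \<Rightarrow> ((nat \<Rightarrow> real) \<Rightarrow> real) \<Rightarrow>
     (nat \<Rightarrow> real) measure \<Rightarrow> real" where
  "lattice_kernel_integral s a b N g f \<mu> =
     1 / real N * (\<Sum>n<N. cos_expansion s a b f (tent_point s a b N g n) *
                          kernel_integral s a b \<mu> (tent_point s a b N g n))"

definition dual_lattice :: "nat \<Rightarrow> nat \<Rightarrow> (nat \<Rightarrow> nat) \<Rightarrow> (nat \<Rightarrow> int) set" where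
  "dual_lattice s N g = {h \<in> int_vecs s. [(\<Sum>j<s. h j * int (g j)) = 0] (mod int N)}"

end

theory Submission
  imports Defs
begin

text \<open>
  The cosine series of \<open>f\<close> is first written over all of \<open>\<int>\<^sup>s\<close>: with
  \<open>c k = f\<^sub>c\<^sub>o\<^sub>s(\<bar>k\<bar>) / \<surd>2^\<bar>k\<bar>\<^sub>0\<close> (\<open>sym_coeff\<close>), each \<open>k \<in> \<nat>\<^sup>s\<close> being shared among its
  \<open>2^\<bar>k\<bar>\<^sub>0\<close> sign patterns, the expansion is \<open>\<Sum>\<^sub>k c k \<Prod>\<^sub>j cos (\<pi> k\<^sub>j x\<^sub>j)\<close>, where \<open>x\<close> is the
  argument mapped affinely to the unit cube, and the squared norm of \<open>f\<close> is
  \<open>\<Sum>\<^sub>k (c k)\<^sup>2 / r k\<close>.  Let \<open>m k\<close> be the integral of the cosine product against \<open>\<mu>\<close>.  At a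
  tent-transformed lattice point each factor is \<open>cos (2 \<pi> n g\<^sub>j k\<^sub>j / N)\<close>, and as \<open>c\<close> and \<open>m\<close> are
  even in every coordinate, the cosine product may be replaced by the character
  \<open>exp (2 \<pi> \<i> n (g \<cdot> k) / N)\<close>, both in the expansion and in the kernel integral.
  Averaging the product of the two series over \<open>n\<close> annihilates every frequency outside the dual
  lattice (\<open>lattice_rule_aliasing\<close>), so the lattice rule gives \<open>\<Sum>\<^sub>h\<^sub>\<in>\<^sub>L (\<Sum>\<^sub>k c k m (h - k))\<close>.
  Its term \<open>h = 0\<close> is the exact integral; the error is the sum over \<open>h \<noteq> 0\<close>.

  The error is bounded by two applications of Cauchy-Schwarz (\<open>convolution_bound\<close>).  Write
  \<open>\<langle>n\<rangle> = max 1 \<bar>n\<bar>\<close>.  The inner sum is split with the weight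
  \<open>T h k = \<Prod>\<^sub>j (\<langle>h\<^sub>j - k\<^sub>j\<rangle>\<^sup>-\<^sup>\<beta> + \<langle>k\<^sub>j\<rangle>^(-2\<alpha>))\<close>, whose sum over \<open>k\<close> does not depend on \<open>h\<close>.
  What remains is to bound \<open>\<Sum>\<^sub>h (r k / r h) r\<^sub>\<beta>(h - k) / T h k\<close> uniformly in \<open>k\<close>; this is a product
  of one-dimensional sums, and in one dimension \<open>\<langle>h\<rangle>^(2\<alpha>) \<le> 2^(2\<alpha>) (\<langle>k\<rangle>^(2\<alpha>) + \<langle>h - k\<rangle>^(2\<alpha>))\<close>
  matches the two summands of the weight and leaves \<open>\<langle>h - k\<rangle>\<^sup>-\<^sup>\<beta> + \<langle>h - k\<rangle>^(2\<alpha> - 2\<beta>)\<close>, which is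
  summable over \<open>h\<close> because \<open>\<alpha> > 1/2\<close> and \<open>\<beta> - \<alpha> > 1/2\<close> (\<open>transfer1_sum\<close>).  The constant is the
  product of these two one-dimensional bounds.
\<close>

section \<open>Unconditional sums\<close>

lemma Cauchy_Schwarz_infsum:
  fixes u v :: "'a \<Rightarrow> real"
  assumes u: "(\<lambda>x. (u x)\<^sup>2) summable_on A" and v: "(\<lambda>x. (v x)\<^sup>2) summable_on A"
  shows "(\<lambda>x. \<bar>u x * v x\<bar>) summable_on A"
    and "(\<Sum>\<^sub>\<infinity>x\<in>A. \<bar>u x * v x\<bar>) \<le> sqrt (\<Sum>\<^sub>\<infinity>x\<in>A. (u x)\<^sup>2) * sqrt (\<Sum>\<^sub>\<infinity>x\<in>A. (v x)\<^sup>2)"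
proof -
  let ?B = "sqrt (\<Sum>\<^sub>\<infinity>x\<in>A. (u x)\<^sup>2) * sqrt (\<Sum>\<^sub>\<infinity>x\<in>A. (v x)\<^sup>2)"
  have fin: "(\<Sum>x\<in>F. \<bar>u x * v x\<bar>) \<le> ?B" if "finite F" "F \<subseteq> A" for F
  proof -
    have "(\<Sum>x\<in>F. \<bar>u x * v x\<bar>) \<le> L2_set u F * L2_set v F"
      using L2_set_mult_ineq[of u v F] by (simp add: abs_mult)
    also have "\<dots> \<le> ?B"
      unfolding L2_set_def using that u v
      by (intro mult_mono real_sqrt_le_mono finite_sum_le_infsum) (auto simp: infsum_nonneg sum_nonneg)
    finally show ?thesis .
  qed
  show *: "(\<lambda>x. \<bar>u x * v x\<bar>) summable_on A"
    by (rule nonneg_bounded_partial_sums_imp_summable_on[where C = ?B])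
       (auto simp: eventually_finite_subsets_at_top intro!: exI[of _ "{}"] fin)
  show "(\<Sum>\<^sub>\<infinity>x\<in>A. \<bar>u x * v x\<bar>) \<le> ?B"
    by (rule infsum_le_finite_sums[OF * fin])
qed

lemma has_sum_prod_PiE_pos:
  fixes f :: "'a \<Rightarrow> 'b \<Rightarrow> real"
  assumes fin: "finite A"
    and sm: "\<And>x. x \<in> A \<Longrightarrow> f x summable_on B x"
    and pos: "\<And>x y. x \<in> A \<Longrightarrow> y \<in> B x \<Longrightarrow> f x y > 0"
    and ne: "\<And>x. x \<in> A \<Longrightarrow> B x \<noteq> {}"
  shows "((\<lambda>g. \<Prod>x\<in>A. f x (g x)) has_sum (\<Prod>x\<in>A. infsum (f x) (B x))) (PiE A B)"
proof -
  have eq: "infsum (\<lambda>g. \<Prod>x\<in>A. f x (g x)) (PiE A B) = (\<Prod>x\<in>A. infsum (f x) (B x))"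
    by (intro infsum_prod_PiE_abs fin iffD1[OF summable_on_iff_abs_summable_on_real] sm)
  have "infsum (f x) (B x) > 0" if x: "x \<in> A" for x
  proof -
    obtain y where y: "y \<in> B x" using ne[OF x] by auto
    have "f x y \<le> infsum (f x) (B x)"
      using finite_sum_le_infsum[OF sm[OF x], of "{y}"] y pos[OF x] by (auto intro: less_imp_le)
    with pos[OF x y] show ?thesis by linarith
  qed
  then have "(\<Prod>x\<in>A. infsum (f x) (B x)) > 0"
    by (simp add: prod_pos)
  \<comment> \<open>Divergent sums have the default value \<open>0\<close>, so a nonzero value certifies convergence.\<close>
  then have "infsum (\<lambda>g. \<Prod>x\<in>A. f x (g x)) (PiE A B) \<noteq> 0"
    unfolding eq by simp
  then have "(\<lambda>g. \<Prod>x\<in>A. f x (g x)) summable_on PiE A B"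
    using infsum_not_exists by blast
  then show ?thesis unfolding eq[symmetric] by (rule has_sum_infsum)
qed

lemma summable_on_bounded_mult:
  fixes c v :: "'a \<Rightarrow> real"
  assumes "c summable_on A" "\<And>k. \<bar>v k\<bar> \<le> 1"
  shows "(\<lambda>k. c k * v k) summable_on A"
proof (rule abs_summable_summable, rule summable_on_comparison_test)
  show "(\<lambda>k. \<bar>c k\<bar>) summable_on A"
    using assms(1) summable_on_iff_abs_summable_on_real[THEN iffD1] by fastforce
qed (use assms(2) in \<open>auto simp: abs_mult intro: mult_left_le\<close>)

lemma has_sum_sum_finite:
  fixes f :: "'i \<Rightarrow> 'a \<Rightarrow> 'b :: real_normed_vector"
  assumes "finite I" "\<And>i. i \<in> I \<Longrightarrow> (f i has_sum S i) A"
  shows "((\<lambda>x. \<Sum>i\<in>I. f i x) has_sum (\<Sum>i\<in>I. S i)) A"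
  using assms by induction (auto intro: has_sum_add)

text \<open>An unconditional sum over a countable index set, as an absolutely convergent series over the
  indices of the standard enumeration, padded with zeros.\<close>

lemma countable_infsum_sums:
  fixes f :: "'a \<Rightarrow> real"
  assumes "countable A" "f summable_on A"
  defines "u \<equiv> \<lambda>i. if i \<in> to_nat_on A ` A then f (from_nat_into A i) else 0"
  shows "u sums (\<Sum>\<^sub>\<infinity>x\<in>A. f x)" and "summable (\<lambda>i. \<bar>u i\<bar>)"
proof -
  have bij: "bij_betw (from_nat_into A) (to_nat_on A ` A) A"
    using assms(1) by (intro bij_betwI[where g = "to_nat_on A"]) auto
  have *: "((\<lambda>i. if i \<in> to_nat_on A ` A then g (from_nat_into A i) else 0) has_sum (\<Sum>\<^sub>\<infinity>x\<in>A. g x)) UNIV"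
    if "g summable_on A" for g :: "'a \<Rightarrow> real"
  proof -
    have "((\<lambda>i. g (from_nat_into A i)) has_sum (\<Sum>\<^sub>\<infinity>x\<in>A. g x)) (to_nat_on A ` A)"
      using has_sum_reindex_bij_betw[OF bij, of g] that by simp
    then show ?thesis
      by (rule has_sum_cong_neutral[THEN iffD1, rotated -1]) auto
  qed
  show "u sums (\<Sum>\<^sub>\<infinity>x\<in>A. f x)"
    unfolding u_def by (intro has_sum_imp_sums * assms)
  have "(\<lambda>x. \<bar>f x\<bar>) summable_on A"
    using assms(2) summable_on_iff_abs_summable_on_real[THEN iffD1] by fastforce
  from has_sum_imp_sums[OF *[OF this]] have "summable (\<lambda>i. if i \<in> to_nat_on A ` A then \<bar>f (from_nat_into A i)\<bar> else 0)"
    by (rule sums_summable)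
  also have "(\<lambda>i. if i \<in> to_nat_on A ` A then \<bar>f (from_nat_into A i)\<bar> else 0) = (\<lambda>i. \<bar>u i\<bar>)"
    by (auto simp: u_def)
  finally show "summable (\<lambda>i. \<bar>u i\<bar>)" .
qed

text \<open>Termwise integration: dominated convergence for an unconditional sum of functions bounded by
  the terms of a convergent sum.\<close>

lemma integral_infsum_bounded:
  fixes \<phi> :: "'k \<Rightarrow> 'x \<Rightarrow> real"
  assumes M: "finite_measure M" and A: "countable A"
    and meas: "\<And>k. k \<in> A \<Longrightarrow> \<phi> k \<in> borel_measurable M"
    and bound: "\<And>k x. k \<in> A \<Longrightarrow> \<bar>\<phi> k x\<bar> \<le> B k"
    and B: "B summable_on A"
  shows "(LINT x|M. (\<Sum>\<^sub>\<infinity>k\<in>A. \<phi> k x)) = (\<Sum>\<^sub>\<infinity>k\<in>A. (LINT x|M. \<phi> k x))"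
proof -
  interpret finite_measure M by (rule M)
  let ?I = "to_nat_on A ` A" and ?a = "from_nat_into A"
  define \<psi> where "\<psi> i x = (if i \<in> ?I then \<phi> (?a i) x else 0)" for i x
  define b where "b i = (if i \<in> ?I then B (?a i) else 0)" for i
  have a: "?a i \<in> A" if "i \<in> ?I" for i
    using that A by auto
  have B0: "B k \<ge> 0" if "k \<in> A" for k using bound[OF that, of undefined] by linarith
  have b0: "b i \<ge> 0" for i using B0 a by (auto simp: b_def)
  have \<psi>b: "\<bar>\<psi> i x\<bar> \<le> b i" for i x using bound a by (auto simp: \<psi>_def b_def)
  have [measurable]: "\<psi> i \<in> borel_measurable M" for i
    unfolding \<psi>_def[abs_def] using meas a by (cases "i \<in> ?I") auto
  have int: "integrable M (\<psi> i)" for i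
    by (rule integrable_const_bound[where B = "b i"]) (use \<psi>b in auto)
  have bsum: "summable b"
    using countable_infsum_sums(2)[OF A B] b0 by (simp add: b_def[symmetric])
  have \<phi>sum: "(\<lambda>k. \<phi> k x) summable_on A" for x
    by (rule abs_summable_summable, rule summable_on_comparison_test[OF B]) (use bound in auto)
  have Lle: "\<bar>(LINT x|M. \<bar>\<psi> i x\<bar>)\<bar> \<le> b i * measure M (space M)" for i
  proof -
    have "(LINT x|M. \<bar>\<psi> i x\<bar>) \<le> (LINT x|M. b i)"
      by (intro integral_mono integrable_abs int) (use \<psi>b in auto)
    then show ?thesis by (simp add: mult.commute)
  qed
  have L\<phi>: "\<bar>(LINT x|M. \<phi> k x)\<bar> \<le> B k * measure M (space M)" if k: "k \<in> A" for k
  proof -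
    have ik: "integrable M (\<phi> k)"
      by (rule integrable_const_bound[where B = "B k"]) (use bound meas k in auto)
    have "\<bar>(LINT x|M. \<phi> k x)\<bar> \<le> (LINT x|M. \<bar>\<phi> k x\<bar>)"
      using integral_norm_bound[of M "\<phi> k"] by simp
    also have "\<dots> \<le> (LINT x|M. B k)"
      by (intro integral_mono integrable_abs ik) (use bound k in auto)
    finally show ?thesis by (simp add: mult.commute)
  qed
  have Lsum: "(\<lambda>k. LINT x|M. \<phi> k x) summable_on A"
    by (rule abs_summable_summable, rule summable_on_comparison_test[OF summable_on_cmult_left[OF B]])
       (use L\<phi> in auto)
  have "(LINT x|M. (\<Sum>\<^sub>\<infinity>k\<in>A. \<phi> k x)) = (LINT x|M. (\<Sum>i. \<psi> i x))"
    using sums_unique[OF countable_infsum_sums(1)[OF A \<phi>sum]] by (simp add: \<psi>_def)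
  also have "\<dots> = (\<Sum>i. (LINT x|M. \<psi> i x))"
  proof (rule integral_suminf[OF int])
    show "AE x in M. summable (\<lambda>i. norm (\<psi> i x))"
      by (intro AE_I2 summable_comparison_test'[OF bsum]) (use \<psi>b in auto)
    show "summable (\<lambda>i. LINT x|M. norm (\<psi> i x))"
      by (rule summable_comparison_test'[OF summable_mult2[OF bsum]]) (use Lle in auto)
  qed
  also have "\<dots> = (\<Sum>\<^sub>\<infinity>k\<in>A. (LINT x|M. \<phi> k x))"
  proof -
    have "(LINT x|M. \<psi> i x) = (if i \<in> ?I then (LINT x|M. \<phi> (?a i) x) else 0)" for i
      by (simp add: \<psi>_def)
    then show ?thesis
      using sums_unique[OF countable_infsum_sums(1)[OF A Lsum]] by simp
  qed
  finally show ?thesis .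
qed

section \<open>One-dimensional weights\<close>

text \<open>The modulus of an integer, raised to \<open>1\<close> at the origin so that negative powers make sense
  there.  Up to constants, \<open>r1 \<alpha> \<gamma> k\<close> is its power with exponent \<open>-2 \<alpha>\<close>.\<close>

definition bracket :: "int \<Rightarrow> real" where
  "bracket n = max 1 \<bar>real_of_int n\<bar>"

lemma bracket_ge_1: "bracket n \<ge> 1"
  by (simp add: bracket_def)

lemma bracket_pos [simp]: "bracket n > 0"
  using bracket_ge_1[of n] by linarith

lemma bracket_nz [simp]: "bracket n \<noteq> 0"
  using bracket_pos[of n] by linarith

lemma summable_on_bracket:
  assumes "p > 1"
  shows "(\<lambda>n. bracket n powr (-p)) summable_on UNIV"
proof -
  have s: "summable (\<lambda>n. bracket (int n) powr (-p))"
  proof (rule summable_comparison_test_ev)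
    show "\<forall>\<^sub>F n in sequentially. norm (bracket (int n) powr (-p)) \<le> real n powr (-p)"
      using eventually_ge_at_top[of 1] by eventually_elim (auto simp: bracket_def max_def)
    show "summable (\<lambda>n. real n powr (-p))"
      using assms by (simp add: summable_real_powr_iff)
  qed
  then have s': "(\<lambda>n. bracket (int n) powr (-p)) summable_on UNIV"
    by (simp add: summable_on_UNIV_nonneg_real_iff)
  have 1: "(\<lambda>n. bracket n powr (-p)) summable_on range int"
    by (subst summable_on_reindex) (use s' in \<open>auto simp: o_def inj_on_def\<close>)
  have 2: "(\<lambda>n. bracket n powr (-p)) summable_on range (\<lambda>n. - int n)"
    by (subst summable_on_reindex) (use s' in \<open>auto simp: o_def inj_on_def bracket_def\<close>)
  have "range int \<union> range (\<lambda>n. - int n) = UNIV"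
    by (auto simp: image_iff) (metis int_cases2)
  with summable_on_union[OF 1 2] show ?thesis by simp
qed

text \<open>The sum of the powers with exponent \<open>-p\<close>; meaningful only for \<open>p > 1\<close>.\<close>

definition bracket_sum :: "real \<Rightarrow> real" where
  "bracket_sum p = (\<Sum>\<^sub>\<infinity>n. bracket n powr (-p))"

lemma bracket_sum_nonneg: "bracket_sum p \<ge> 0"
  unfolding bracket_sum_def by (intro infsum_nonneg) simp

lemma bracket_shift:
  assumes "p > 1"
  shows "((\<lambda>k. bracket (h - k) powr (-p)) has_sum bracket_sum p) UNIV"
    and "((\<lambda>h. bracket (h - k) powr (-p)) has_sum bracket_sum p) UNIV"
proof -
  have *: "((\<lambda>k. bracket k powr (-p)) has_sum bracket_sum p) UNIV"
    unfolding bracket_sum_def using summable_on_bracket[OF assms] by (rule has_sum_infsum)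
  have b: "bij_betw (\<lambda>k. h - k) UNIV (UNIV::int set)" "bij_betw (\<lambda>h. h - k) UNIV (UNIV::int set)"
    by (rule bij_betwI[where g = "\<lambda>k. h - k"], simp_all, rule bij_betwI[where g = "\<lambda>h. h + k"], simp_all)
  show "((\<lambda>k. bracket (h - k) powr (-p)) has_sum bracket_sum p) UNIV"
    using has_sum_reindex_bij_betw[OF b(1), of "\<lambda>k. bracket k powr (-p)"] * by simp
  show "((\<lambda>h. bracket (h - k) powr (-p)) has_sum bracket_sum p) UNIV"
    using has_sum_reindex_bij_betw[OF b(2), of "\<lambda>k. bracket k powr (-p)"] * by simp
qed

lemma r1_pos: "\<gamma> > 0 \<Longrightarrow> r1 \<alpha> \<gamma> k > 0"
  by (simp add: r1_def)

lemma r1_bracket: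
  assumes "\<gamma> > 0"
  shows "min 1 \<gamma> * bracket k powr (-2 * \<alpha>) \<le> r1 \<alpha> \<gamma> k"
    and "r1 \<alpha> \<gamma> k \<le> max 1 \<gamma> * bracket k powr (-2 * \<alpha>)"
proof -
  have "bracket k = \<bar>real_of_int k\<bar>" if "k \<noteq> 0"
    using that by (simp add: bracket_def max_def)
  moreover have "bracket 0 = 1" by (simp add: bracket_def)
  ultimately show "min 1 \<gamma> * bracket k powr (-2 * \<alpha>) \<le> r1 \<alpha> \<gamma> k"
    and "r1 \<alpha> \<gamma> k \<le> max 1 \<gamma> * bracket k powr (-2 * \<alpha>)"
    by (auto simp: r1_def intro!: mult_right_mono)
qed

lemma bracket_quasi_triangle:
  assumes "\<alpha> > 0"
  shows "bracket h powr (2 * \<alpha>) \<le> 2 powr (2 * \<alpha>) * (bracket k powr (2 * \<alpha>) + bracket (h - k) powr (2 * \<alpha>))"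
proof -
  have "bracket h \<le> 2 * max (bracket k) (bracket (h - k))"
    unfolding bracket_def by (auto simp: max_def abs_if)
  then have "bracket h powr (2 * \<alpha>) \<le> (2 * max (bracket k) (bracket (h - k))) powr (2 * \<alpha>)"
    using assms by (intro powr_mono2) (auto intro: less_imp_le)
  also have "\<dots> = 2 powr (2 * \<alpha>) * max (bracket k) (bracket (h - k)) powr (2 * \<alpha>)"
    by (rule powr_mult)
  also have "\<dots> \<le> 2 powr (2 * \<alpha>) * (bracket k powr (2 * \<alpha>) + bracket (h - k) powr (2 * \<alpha>))"
    by (intro mult_left_mono) (auto simp: max_def)
  finally show ?thesis .
qed

text \<open>The one-dimensional weight with which the convolution is split in Cauchy-Schwarz.  The first
  summand serves the pairs with \<open>h\<close> of the size of \<open>k\<close>, the second those with \<open>h\<close> of the size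
  of \<open>h - k\<close>.\<close>

definition split_weight :: "real \<Rightarrow> real \<Rightarrow> int \<Rightarrow> int \<Rightarrow> real" where
  "split_weight \<alpha> \<beta> h k = bracket (h - k) powr (- \<beta>) + bracket k powr (- 2 * \<alpha>)"

lemma split_weight_pos [simp]: "split_weight \<alpha> \<beta> h k > 0"
  by (simp add: split_weight_def add_pos_pos)

lemma split_weight_has_sum:
  assumes "\<alpha> > 1/2" "\<beta> > 1"
  shows "((\<lambda>k. split_weight \<alpha> \<beta> h k) has_sum (bracket_sum \<beta> + bracket_sum (2 * \<alpha>))) UNIV"
proof -
  have "((\<lambda>k. bracket k powr (- 2 * \<alpha>)) has_sum bracket_sum (2 * \<alpha>)) UNIV"
    using bracket_shift(2)[of "2 * \<alpha>" 0] assms by simp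
  from has_sum_add[OF bracket_shift(1)[OF assms(2), of h] this] show ?thesis
    by (simp add: split_weight_def)
qed

text \<open>What is left of one coordinate once the weight has been split off: the factor by which the
  frequency \<open>k\<close> of the function contributes to the frequency \<open>h\<close> of the convolution, both measured
  relative to \<open>r1 \<alpha> \<gamma>\<close>.\<close>

definition transfer1 :: "real \<Rightarrow> real \<Rightarrow> real \<Rightarrow> real \<Rightarrow> int \<Rightarrow> int \<Rightarrow> real" where
  "transfer1 \<alpha> \<beta> \<gamma> \<rho> h k =
     r1 \<alpha> \<gamma> k / r1 \<alpha> \<gamma> h * r1 \<beta> \<rho> (h - k) / split_weight \<alpha> \<beta> h k"

text \<open>A bound for the sum of \<open>transfer1\<close> over \<open>h\<close> that is uniform in \<open>k\<close>.\<close>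

definition transfer_const :: "real \<Rightarrow> real \<Rightarrow> real \<Rightarrow> real \<Rightarrow> real" where
  "transfer_const \<alpha> \<beta> \<gamma> \<rho> =
     max 1 \<gamma> / min 1 \<gamma> * max 1 \<rho> * 2 powr (2 * \<alpha>) * (bracket_sum \<beta> + bracket_sum (2 * \<beta> - 2 * \<alpha>))"

lemma transfer1_le:
  fixes h k :: int
  assumes "\<alpha> > 1/2" "\<gamma> > 0" "\<rho> > 0"
  shows "transfer1 \<alpha> \<beta> \<gamma> \<rho> h k \<le> max 1 \<gamma> / min 1 \<gamma> * max 1 \<rho> * 2 powr (2 * \<alpha>) *
           (bracket (h - k) powr (- \<beta>) + bracket (h - k) powr (- (2 * \<beta> - 2 * \<alpha>)))"
proof -
  define x y z where "x = bracket k powr (2 * \<alpha>)" and "y = bracket (h - k) powr (2 * \<alpha>)"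
    and "z = bracket h powr (2 * \<alpha>)"
  define u where "u = bracket (h - k) powr (- \<beta>)"
  define w where "w = u + 1 / x"
  have pos: "x > 0" "y > 0" "z > 0" "u > 0" "w > 0"
    by (auto simp: x_def y_def z_def u_def w_def intro!: add_pos_pos)
  have x': "bracket k powr (- 2 * \<alpha>) = 1 / x" and z': "bracket h powr (- 2 * \<alpha>) = 1 / z"
    by (simp_all add: x_def z_def powr_minus_divide)
  have u': "bracket (h - k) powr (- 2 * \<beta>) = u * u"
    by (simp add: u_def flip: powr_add)
  have yu: "bracket (h - k) powr (- (2 * \<beta> - 2 * \<alpha>)) = y * (u * u)"
    by (simp add: u_def y_def flip: powr_add)
  define K where "K = max 1 \<gamma> / min 1 \<gamma> * max 1 \<rho>"
  have K: "K > 0" using assms by (simp add: K_def)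
  have sw: "split_weight \<alpha> \<beta> h k = w"
    unfolding split_weight_def x' w_def u_def by simp
  have "r1 \<alpha> \<gamma> k / r1 \<alpha> \<gamma> h \<le> (max 1 \<gamma> * (1 / x)) / (min 1 \<gamma> * (1 / z))"
    using r1_bracket(2)[OF assms(2), where k = k and \<alpha> = \<alpha>] r1_bracket(1)[OF assms(2), where k = h and \<alpha> = \<alpha>] assms(2) pos
    unfolding x' z' by (intro frac_le) auto
  moreover have "r1 \<beta> \<rho> (h - k) \<le> max 1 \<rho> * (u * u)"
    using r1_bracket(2)[OF assms(3), where k = "h - k" and \<alpha> = \<beta>] unfolding u' .
  ultimately have "transfer1 \<alpha> \<beta> \<gamma> \<rho> h k \<le>
      (max 1 \<gamma> * (1 / x)) / (min 1 \<gamma> * (1 / z)) * (max 1 \<rho> * (u * u)) / w"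
    unfolding transfer1_def sw using assms(2,3) pos
    by (intro divide_right_mono mult_mono) (auto intro: less_imp_le[OF r1_pos])
  also have "\<dots> = K * (z * (u * u / (x * w)))"
    using pos by (simp add: K_def mult_ac)
  also have "\<dots> \<le> K * (2 powr (2 * \<alpha>) * (x + y) * (u * u / (x * w)))"
    using assms bracket_quasi_triangle[of \<alpha> h k] pos K unfolding x_def[symmetric] y_def[symmetric] z_def[symmetric]
    by (intro mult_left_mono mult_right_mono) auto
  also have "\<dots> = K * 2 powr (2 * \<alpha>) * ((x + y) * (u * u) / (x * w))"
    by simp
  \<comment> \<open>As \<open>x * w = x * u + 1\<close> dominates both \<open>x * u\<close> and \<open>1\<close>, it absorbs \<open>x * u\<^sup>2\<close> and \<open>y * u\<^sup>2\<close> in turn.\<close>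
  also have "\<dots> \<le> K * 2 powr (2 * \<alpha>) * (u + y * (u * u))"
  proof (intro mult_left_mono)
    have "x * w * (u + y * (u * u)) = (x + y) * (u * u) + x * (y * u * u * u) + u"
      using pos by (simp add: w_def field_simps)
    with pos have "(x + y) * (u * u) \<le> (u + y * (u * u)) * (x * w)"
      by (simp add: mult.commute)
    with pos show "(x + y) * (u * u) / (x * w) \<le> u + y * (u * u)"
      by (simp add: pos_divide_le_eq)
  qed (use K in auto)
  finally show ?thesis unfolding K_def yu unfolding u_def .
qed

lemma transfer1_pos: "\<gamma> > 0 \<Longrightarrow> \<rho> > 0 \<Longrightarrow> transfer1 \<alpha> \<beta> \<gamma> \<rho> h k > 0"
  by (simp add: transfer1_def r1_pos)

lemma transfer1_sum:
  assumes "\<alpha> > 1/2" "\<beta> - \<alpha> > 1/2" "\<gamma> > 0" "\<rho> > 0"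
  shows "(\<lambda>h. transfer1 \<alpha> \<beta> \<gamma> \<rho> h k) summable_on UNIV"
    and "(\<Sum>\<^sub>\<infinity>h. transfer1 \<alpha> \<beta> \<gamma> \<rho> h k) \<le> transfer_const \<alpha> \<beta> \<gamma> \<rho>"
proof -
  have s: "((\<lambda>h. max 1 \<gamma> / min 1 \<gamma> * max 1 \<rho> * 2 powr (2 * \<alpha>) *
           (bracket (h - k) powr (- \<beta>) + bracket (h - k) powr (- (2 * \<beta> - 2 * \<alpha>))))
           has_sum transfer_const \<alpha> \<beta> \<gamma> \<rho>) UNIV"
    unfolding transfer_const_def using assms
    by (intro has_sum_cmult_right has_sum_add bracket_shift) auto
  note le = transfer1_le[OF assms(1,3,4), of \<beta> _ k]
  show *: "(\<lambda>h. transfer1 \<alpha> \<beta> \<gamma> \<rho> h k) summable_on UNIV"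
    by (rule summable_on_comparison_test[OF has_sum_imp_summable[OF s] le])
       (use transfer1_pos[OF assms(3,4)] in \<open>auto intro: less_imp_le\<close>)
  show "(\<Sum>\<^sub>\<infinity>h. transfer1 \<alpha> \<beta> \<gamma> \<rho> h k) \<le> transfer_const \<alpha> \<beta> \<gamma> \<rho>"
    using infsum_mono[OF * has_sum_imp_summable[OF s] le] infsumI[OF s] by simp
qed

lemma r_pos: "(\<And>j. j < s \<Longrightarrow> \<gamma> j > 0) \<Longrightarrow> r s \<alpha> \<gamma> k > 0"
  unfolding r_def by (intro prod_pos) (auto intro: r1_pos)

lemma summable_on_r1:
  assumes "\<alpha> > 1/2" "\<gamma> > 0"
  shows "r1 \<alpha> \<gamma> summable_on UNIV"
proof (rule summable_on_comparison_test)
  show "(\<lambda>k. max 1 \<gamma> * bracket k powr (-2 * \<alpha>)) summable_on UNIV"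
    using summable_on_bracket[of "2 * \<alpha>"] assms by (intro summable_on_cmult_right) auto
qed (use r1_bracket(2)[OF assms(2)] in \<open>auto intro: less_imp_le[OF r1_pos] assms\<close>)

lemma summable_on_sqrt_r1:
  assumes "\<beta> > 1" "\<rho> > 0"
  shows "(\<lambda>k. sqrt (r1 \<beta> \<rho> k)) summable_on UNIV"
proof (rule summable_on_comparison_test)
  show "(\<lambda>k. sqrt (max 1 \<rho>) * bracket k powr (-\<beta>)) summable_on UNIV"
    using summable_on_bracket[of \<beta>] assms by (intro summable_on_cmult_right) auto
  fix k
  have "bracket k powr (-2 * \<beta>) = (bracket k powr (-\<beta>))\<^sup>2"
    by (simp add: power2_eq_square flip: powr_add)
  then show "sqrt (r1 \<beta> \<rho> k) \<le> sqrt (max 1 \<rho>) * bracket k powr (-\<beta>)"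
    using real_sqrt_le_mono[OF r1_bracket(2)[OF assms(2), of \<beta> k]] by (simp add: real_sqrt_mult)
qed (auto intro: less_imp_le[OF r1_pos] assms)

lemma summable_on_r:
  assumes "\<alpha> > 1/2" "\<And>j. j < s \<Longrightarrow> \<gamma> j > 0"
  shows "r s \<alpha> \<gamma> summable_on int_vecs s"
  unfolding r_def int_vecs_def
  by (rule has_sum_imp_summable[OF has_sum_prod_PiE_pos])
     (use assms in \<open>auto intro: summable_on_r1 r1_pos\<close>)

lemma summable_on_sqrt_r:
  assumes "\<beta> > 1" "\<And>j. j < s \<Longrightarrow> \<rho> j > 0"
  shows "(\<lambda>k. sqrt (r s \<beta> \<rho> k)) summable_on int_vecs s"
proof -
  have "sqrt (\<Prod>j\<in>J. f j) = (\<Prod>j\<in>J. sqrt (f j))" if "finite J" for J and f :: "nat \<Rightarrow> real"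
    using that by induction (auto simp: real_sqrt_mult)
  then show ?thesis
    unfolding r_def int_vecs_def
    by (simp, intro has_sum_imp_summable[OF has_sum_prod_PiE_pos])
       (use assms in \<open>auto intro: summable_on_sqrt_r1 r1_pos\<close>)
qed

section \<open>The convolution estimate\<close>

text \<open>Componentwise difference, kept extensional so that it stays inside \<^term>\<open>int_vecs s\<close>.\<close>

definition vec_diff :: "nat \<Rightarrow> (nat \<Rightarrow> int) \<Rightarrow> (nat \<Rightarrow> int) \<Rightarrow> nat \<Rightarrow> int" where
  "vec_diff s h k = (\<lambda>j\<in>{..<s}. h j - k j)"

lemma vec_diff_in [simp]: "vec_diff s h k \<in> int_vecs s"
  by (simp add: vec_diff_def int_vecs_def)

lemma vec_diff_nth [simp]: "j < s \<Longrightarrow> vec_diff s h k j = h j - k j"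
  by (simp add: vec_diff_def)

lemma prod_split_weight_has_sum:
  assumes "\<alpha> > 1/2" "\<beta> > 1"
  shows "((\<lambda>k. \<Prod>j<s. split_weight \<alpha> \<beta> (h j) (k j)) has_sum
           (\<Prod>j<s. bracket_sum \<beta> + bracket_sum (2 * \<alpha>))) (int_vecs s)"
proof -
  note S = split_weight_has_sum[OF assms]
  have "((\<lambda>k. \<Prod>j\<in>{..<s}. split_weight \<alpha> \<beta> (h j) (k j)) has_sum
          (\<Prod>j\<in>{..<s}. \<Sum>\<^sub>\<infinity>k. split_weight \<alpha> \<beta> (h j) k)) (int_vecs s)"
    unfolding int_vecs_def
    by (rule has_sum_prod_PiE_pos) (auto intro: has_sum_imp_summable[OF S])
  then show ?thesis by (simp add: infsumI[OF S])
qed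

lemma prod_transfer1_sum:
  assumes "\<alpha> > 1/2" "\<beta> - \<alpha> > 1/2" "\<And>j. j < s \<Longrightarrow> \<gamma> j > 0" "\<And>j. j < s \<Longrightarrow> \<rho> j > 0"
  shows "(\<lambda>h. \<Prod>j<s. transfer1 \<alpha> \<beta> (\<gamma> j) (\<rho> j) (h j) (k j)) summable_on int_vecs s"
    and "(\<Sum>\<^sub>\<infinity>h\<in>int_vecs s. \<Prod>j<s. transfer1 \<alpha> \<beta> (\<gamma> j) (\<rho> j) (h j) (k j))
           \<le> (\<Prod>j<s. transfer_const \<alpha> \<beta> (\<gamma> j) (\<rho> j))"
proof -
  have *: "((\<lambda>h. \<Prod>j\<in>{..<s}. transfer1 \<alpha> \<beta> (\<gamma> j) (\<rho> j) (h j) (k j)) has_sum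
          (\<Prod>j\<in>{..<s}. \<Sum>\<^sub>\<infinity>h. transfer1 \<alpha> \<beta> (\<gamma> j) (\<rho> j) h (k j))) (int_vecs s)"
    unfolding int_vecs_def
    by (rule has_sum_prod_PiE_pos[where f = "\<lambda>j h. transfer1 \<alpha> \<beta> (\<gamma> j) (\<rho> j) h (k j)"])
       (auto intro!: transfer1_sum transfer1_pos assms)
  then show "(\<lambda>h. \<Prod>j<s. transfer1 \<alpha> \<beta> (\<gamma> j) (\<rho> j) (h j) (k j)) summable_on int_vecs s"
    by (rule has_sum_imp_summable)
  show "(\<Sum>\<^sub>\<infinity>h\<in>int_vecs s. \<Prod>j<s. transfer1 \<alpha> \<beta> (\<gamma> j) (\<rho> j) (h j) (k j))
           \<le> (\<Prod>j<s. transfer_const \<alpha> \<beta> (\<gamma> j) (\<rho> j))"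
    unfolding infsumI[OF *] using assms
    by (intro prod_mono conjI transfer1_sum infsum_nonneg less_imp_le[OF transfer1_pos]) auto
qed

text \<open>The one-dimensional constant: the total mass of the split weight times the transfer bound.\<close>

definition conv_const :: "real \<Rightarrow> real \<Rightarrow> real \<Rightarrow> real \<Rightarrow> real" where
  "conv_const \<alpha> \<beta> \<gamma> \<rho> = (bracket_sum \<beta> + bracket_sum (2 * \<alpha>)) * transfer_const \<alpha> \<beta> \<gamma> \<rho>"

text \<open>If \<open>c\<close> has finite norm relative to \<^term>\<open>r s \<alpha> \<gamma>\<close> and \<open>m\<close> decays like the square root of
  \<^term>\<open>r s \<beta> \<rho>\<close>, then the absolute convolution of \<open>c\<close> and \<open>m\<close> is summable over any set \<open>D\<close> of
  frequencies.  Only the sum of \<^term>\<open>r s \<alpha> \<gamma>\<close> in the bound depends on \<open>D\<close>.\<close>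

lemma convolution_bound:
  fixes c m :: "(nat \<Rightarrow> int) \<Rightarrow> real"
  assumes \<alpha>\<beta>: "\<alpha> > 1/2" "\<beta> - \<alpha> > 1/2"
    and \<gamma>: "\<And>j. j < s \<Longrightarrow> \<gamma> j > 0" and \<rho>: "\<And>j. j < s \<Longrightarrow> \<rho> j > 0"
    and c: "(\<lambda>k. (c k)\<^sup>2 / r s \<alpha> \<gamma> k) summable_on int_vecs s"
    and m: "\<And>k. k \<in> int_vecs s \<Longrightarrow> (m k)\<^sup>2 \<le> r s \<beta> \<rho> k"
  shows "(\<lambda>(h, k). \<bar>c k * m (vec_diff s h k)\<bar>) summable_on int_vecs s \<times> int_vecs s"
    and "D \<subseteq> int_vecs s \<Longrightarrow>
      (\<Sum>\<^sub>\<infinity>h\<in>D. \<Sum>\<^sub>\<infinity>k\<in>int_vecs s. \<bar>c k * m (vec_diff s h k)\<bar>)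
        \<le> sqrt (\<Sum>\<^sub>\<infinity>h\<in>D. r s \<alpha> \<gamma> h) * sqrt (\<Prod>j<s. conv_const \<alpha> \<beta> (\<gamma> j) (\<rho> j)) *
           sqrt (\<Sum>\<^sub>\<infinity>k\<in>int_vecs s. (c k)\<^sup>2 / r s \<alpha> \<gamma> k)"
proof -
  let ?Z = "int_vecs s" and ?r = "r s \<alpha> \<gamma>"
  define T where "T h k = (\<Prod>j<s. split_weight \<alpha> \<beta> (h j) (k j))" for h k :: "nat \<Rightarrow> int"
  define Q where "Q h k = (\<Prod>j<s. transfer1 \<alpha> \<beta> (\<gamma> j) (\<rho> j) (h j) (k j))" for h k :: "nat \<Rightarrow> int"
  define w where "w k = (c k)\<^sup>2 / ?r k" for k
  define A where "A = (\<Prod>j<s. bracket_sum \<beta> + bracket_sum (2 * \<alpha>))"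
  define B where "B = (\<Prod>j<s. transfer_const \<alpha> \<beta> (\<gamma> j) (\<rho> j))"
  define W where "W = (\<Sum>\<^sub>\<infinity>k\<in>?Z. w k)"
  have rpos: "?r k > 0" for k by (intro r_pos \<gamma>)
  have Tpos: "T h k > 0" for h k unfolding T_def by (intro prod_pos) auto
  have Qpos: "Q h k > 0" for h k unfolding Q_def by (intro prod_pos) (auto intro: transfer1_pos \<gamma> \<rho>)
  have w0: "w k \<ge> 0" for k unfolding w_def using rpos[of k] by simp
  have A0: "A \<ge> 0" unfolding A_def by (intro prod_nonneg) (auto intro: bracket_sum_nonneg add_nonneg_nonneg)
  have Tsum: "(T h has_sum A) ?Z" for h
    unfolding T_def A_def using prod_split_weight_has_sum \<alpha>\<beta> by auto
  have Qsum: "(\<lambda>h. Q h k) summable_on ?Z" and Qle: "(\<Sum>\<^sub>\<infinity>h\<in>?Z. Q h k) \<le> B" for k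
    unfolding Q_def B_def using prod_transfer1_sum[OF \<alpha>\<beta> \<gamma> \<rho>] by auto
  have Qeq: "Q h k = ?r k / ?r h * r s \<beta> \<rho> (vec_diff s h k) / T h k" for h k
    by (simp add: Q_def transfer1_def r_def T_def prod.distrib prod_dividef)
  \<comment> \<open>Tonelli: the terms \<open>w k * Q h k\<close> are summable over all pairs because the sums over \<open>h\<close>
    are bounded uniformly in \<open>k\<close>.\<close>
  have wS: "w summable_on ?Z" using c unfolding w_def[abs_def] .
  have inner: "((\<lambda>h. w k * Q h k) has_sum w k * (\<Sum>\<^sub>\<infinity>h\<in>?Z. Q h k)) ?Z" for k
    by (intro has_sum_cmult_right has_sum_infsum Qsum)
  have outer: "(\<lambda>k. w k * (\<Sum>\<^sub>\<infinity>h\<in>?Z. Q h k)) summable_on ?Z"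
    by (rule summable_on_comparison_test[OF summable_on_cmult_left[OF wS, of B]])
       (auto intro!: mult_left_mono Qle w0 mult_nonneg_nonneg infsum_nonneg less_imp_le[OF Qpos])
  have KH: "(\<lambda>(k, h). w k * Q h k) summable_on ?Z \<times> ?Z"
    by (rule summable_on_SigmaI[OF _ outer])
       (use inner in \<open>auto intro!: mult_nonneg_nonneg w0 less_imp_le[OF Qpos]\<close>)
  then have HK: "(\<lambda>(h, k). w k * Q h k) summable_on ?Z \<times> ?Z"
    by (subst (asm) summable_on_swap) (simp add: case_prod_unfold)
  define V where "V h = (\<Sum>\<^sub>\<infinity>k\<in>?Z. w k * Q h k)" for h
  have Vin: "(\<lambda>k. w k * Q h k) summable_on ?Z" if "h \<in> ?Z" for h
    using summable_on_SigmaD1[OF HK that] by simp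
  have Vsum: "V summable_on ?Z"
    using summable_on_Sigma_banach[OF HK] unfolding V_def[abs_def] .
  have V0: "V h \<ge> 0" for h
    unfolding V_def by (intro infsum_nonneg mult_nonneg_nonneg w0 less_imp_le[OF Qpos])
  have "(\<Sum>\<^sub>\<infinity>h\<in>?Z. V h) = (\<Sum>\<^sub>\<infinity>k\<in>?Z. \<Sum>\<^sub>\<infinity>h\<in>?Z. w k * Q h k)"
    unfolding V_def by (rule infsum_swap_banach[OF HK])
  also have "\<dots> = (\<Sum>\<^sub>\<infinity>k\<in>?Z. w k * (\<Sum>\<^sub>\<infinity>h\<in>?Z. Q h k))"
    by (intro infsum_cong infsumI inner)
  also have "\<dots> \<le> (\<Sum>\<^sub>\<infinity>k\<in>?Z. w k * B)"
    by (intro infsum_mono outer summable_on_cmult_left[OF wS] mult_left_mono Qle w0)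
  also have "\<dots> = W * B"
    unfolding W_def by (rule infsum_cmult_left[OF wS])
  finally have Vle: "(\<Sum>\<^sub>\<infinity>h\<in>?Z. V h) \<le> W * B" .
  \<comment> \<open>Cauchy-Schwarz in \<open>k\<close>, with the weight \<open>T h k\<close>.\<close>
  define S where "S h = (\<Sum>\<^sub>\<infinity>k\<in>?Z. \<bar>c k * m (vec_diff s h k)\<bar>)" for h
  have S: "(\<lambda>k. \<bar>c k * m (vec_diff s h k)\<bar>) summable_on ?Z \<and> S h \<le> sqrt A * \<bar>sqrt (?r h) * sqrt (V h)\<bar>"
    if h: "h \<in> ?Z" for h
  proof -
    define u v where "u k = sqrt (T h k)" and "v k = c k * m (vec_diff s h k) / sqrt (T h k)" for k
    have uv: "u k * v k = c k * m (vec_diff s h k)" for k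
      using Tpos[of h k] by (simp add: u_def v_def)
    have u2: "((\<lambda>k. (u k)\<^sup>2) has_sum A) ?Z"
      using Tsum[of h] less_imp_le[OF Tpos] by (simp add: u_def)
    have v2: "(v k)\<^sup>2 \<le> ?r h * (w k * Q h k)" for k
    proof -
      have "(v k)\<^sup>2 = (c k)\<^sup>2 * (m (vec_diff s h k))\<^sup>2 / T h k"
        using Tpos[of h k] by (simp add: v_def power_mult_distrib power_divide)
      also have "\<dots> \<le> (c k)\<^sup>2 * r s \<beta> \<rho> (vec_diff s h k) / T h k"
        using Tpos[of h k] by (intro divide_right_mono mult_left_mono m) auto
      also have "\<dots> = ?r h * (w k * Q h k)"
        using rpos[of h] rpos[of k] by (simp add: Qeq w_def)
      finally show ?thesis .
    qed
    have v2s: "(\<lambda>k. ?r h * (w k * Q h k)) summable_on ?Z"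
      by (intro summable_on_cmult_right Vin h)
    have v2s': "(\<lambda>k. (v k)\<^sup>2) summable_on ?Z"
      by (rule summable_on_comparison_test[OF v2s v2]) auto
    have "(\<Sum>\<^sub>\<infinity>k\<in>?Z. (v k)\<^sup>2) \<le> (\<Sum>\<^sub>\<infinity>k\<in>?Z. ?r h * (w k * Q h k))"
      by (intro infsum_mono v2s v2s' v2)
    also have "\<dots> = ?r h * V h"
      unfolding V_def by (rule infsum_cmult_right[OF Vin[OF h]])
    finally have v2le: "(\<Sum>\<^sub>\<infinity>k\<in>?Z. (v k)\<^sup>2) \<le> ?r h * V h" .
    note CS = Cauchy_Schwarz_infsum[OF has_sum_imp_summable[OF u2] v2s', unfolded uv infsumI[OF u2]]
    have "S h \<le> sqrt A * sqrt (\<Sum>\<^sub>\<infinity>k\<in>?Z. (v k)\<^sup>2)"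
      using CS(2) by (simp add: S_def)
    also have "\<dots> \<le> sqrt A * sqrt (?r h * V h)"
      by (intro mult_left_mono real_sqrt_le_mono v2le) (simp add: A0)
    also have "sqrt (?r h * V h) = \<bar>sqrt (?r h) * sqrt (V h)\<bar>"
      using V0[of h] rpos[of h] by (simp add: real_sqrt_mult)
    finally show ?thesis using CS(1) by simp
  qed
  \<comment> \<open>Cauchy-Schwarz in \<open>h\<close>, first over all of \<open>\<int>\<^sup>s\<close> for summability.\<close>
  have r2: "(\<lambda>h. (sqrt (?r h))\<^sup>2) summable_on ?Z"
    using summable_on_r[OF \<alpha>\<beta>(1) \<gamma>, of s] less_imp_le[OF rpos] by simp
  have V2: "(\<lambda>h. (sqrt (V h))\<^sup>2) summable_on ?Z"
    using Vsum V0 by simp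
  have rV: "(\<lambda>h. sqrt A * \<bar>sqrt (?r h) * sqrt (V h)\<bar>) summable_on ?Z"
    by (intro summable_on_cmult_right Cauchy_Schwarz_infsum r2 V2)
  have S0: "S h \<ge> 0" for h unfolding S_def by (intro infsum_nonneg) simp
  have Ssum: "S summable_on ?Z"
    by (rule summable_on_comparison_test[OF rV]) (use S S0 in auto)
  show "(\<lambda>(h, k). \<bar>c k * m (vec_diff s h k)\<bar>) summable_on ?Z \<times> ?Z"
    by (rule summable_on_SigmaI[OF _ Ssum]) (use S in \<open>auto simp: S_def\<close>)
  assume D: "D \<subseteq> ?Z"
  have sub: "f summable_on ?Z \<Longrightarrow> f summable_on D" for f :: "_ \<Rightarrow> real"
    by (rule summable_on_subset_banach[OF _ D])
  have "(\<Sum>\<^sub>\<infinity>h\<in>D. S h) \<le> (\<Sum>\<^sub>\<infinity>h\<in>D. sqrt A * \<bar>sqrt (?r h) * sqrt (V h)\<bar>)"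
    by (intro infsum_mono sub Ssum rV) (use S D in auto)
  also have "\<dots> = sqrt A * (\<Sum>\<^sub>\<infinity>h\<in>D. \<bar>sqrt (?r h) * sqrt (V h)\<bar>)"
    by (intro infsum_cmult_right Cauchy_Schwarz_infsum sub r2 V2)
  also have "\<dots> \<le> sqrt A * (sqrt (\<Sum>\<^sub>\<infinity>h\<in>D. (sqrt (?r h))\<^sup>2) * sqrt (\<Sum>\<^sub>\<infinity>h\<in>D. (sqrt (V h))\<^sup>2))"
    by (intro mult_left_mono Cauchy_Schwarz_infsum sub r2 V2) (simp add: A0)
  also have "\<dots> = sqrt A * (sqrt (\<Sum>\<^sub>\<infinity>h\<in>D. ?r h) * sqrt (\<Sum>\<^sub>\<infinity>h\<in>D. V h))"
    using less_imp_le[OF rpos] V0 by simp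
  also have "(\<Sum>\<^sub>\<infinity>h\<in>D. V h) \<le> W * B"
    by (rule order_trans[OF infsum_mono_neutral Vle]) (use D V0 sub[OF Vsum] Vsum in auto)
  then have "sqrt A * (sqrt (\<Sum>\<^sub>\<infinity>h\<in>D. ?r h) * sqrt (\<Sum>\<^sub>\<infinity>h\<in>D. V h))
      \<le> sqrt A * (sqrt (\<Sum>\<^sub>\<infinity>h\<in>D. ?r h) * sqrt (W * B))"
    by (intro mult_left_mono real_sqrt_le_mono)
       (auto simp: A0 intro!: infsum_nonneg less_imp_le[OF rpos])
  also have "\<dots> = sqrt (\<Sum>\<^sub>\<infinity>h\<in>D. ?r h) * sqrt (\<Prod>j<s. conv_const \<alpha> \<beta> (\<gamma> j) (\<rho> j)) * sqrt W"
    by (simp add: conv_const_def prod.distrib A_def B_def real_sqrt_mult)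
  finally show "(\<Sum>\<^sub>\<infinity>h\<in>D. \<Sum>\<^sub>\<infinity>k\<in>?Z. \<bar>c k * m (vec_diff s h k)\<bar>)
        \<le> sqrt (\<Sum>\<^sub>\<infinity>h\<in>D. ?r h) * sqrt (\<Prod>j<s. conv_const \<alpha> \<beta> (\<gamma> j) (\<rho> j)) *
           sqrt (\<Sum>\<^sub>\<infinity>k\<in>?Z. (c k)\<^sup>2 / ?r k)"
    by (simp add: S_def W_def w_def)
qed

section \<open>Folding sums over sign patterns\<close>

text \<open>Componentwise absolute value, kept extensional.\<close>

definition vec_abs :: "nat \<Rightarrow> (nat \<Rightarrow> int) \<Rightarrow> nat \<Rightarrow> int" where
  "vec_abs s k = (\<lambda>j\<in>{..<s}. \<bar>k j\<bar>)"

lemma vec_abs_in_int [simp]: "vec_abs s k \<in> int_vecs s"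
  by (simp add: vec_abs_def int_vecs_def)

lemma vec_abs_nth [simp]: "j < s \<Longrightarrow> vec_abs s k j = \<bar>k j\<bar>"
  by (simp add: vec_abs_def)

lemma vec_abs_nat:
  assumes "k \<in> nat_vecs s"
  shows "vec_abs s k = k"
proof
  fix j show "vec_abs s k j = k j"
    using assms by (cases "j < s") (auto simp: vec_abs_def nat_vecs_def PiE_iff extensional_def)
qed

lemma vec_abs_cong: "(\<And>j. j < s \<Longrightarrow> \<bar>k j\<bar> = \<bar>l j\<bar>) \<Longrightarrow> vec_abs s k = vec_abs s l"
  by (auto simp: vec_abs_def restrict_def)

lemma vec_abs_idem [simp]: "vec_abs s (vec_abs s k) = vec_abs s k"
  by (auto simp: vec_abs_def)

lemma num_nonzero_vec_abs [simp]: "num_nonzero s (vec_abs s k) = num_nonzero s k"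
proof -
  have "{j. j < s \<and> vec_abs s k j \<noteq> 0} = {j. j < s \<and> k j \<noteq> 0}" by auto
  then show ?thesis by (simp add: num_nonzero_def)
qed

lemma r_vec_abs [simp]: "r s \<alpha> \<gamma> (vec_abs s k) = r s \<alpha> \<gamma> k"
  unfolding r_def by (intro prod.cong) (auto simp: r1_def)

lemma cos_prod_vec_abs [simp]: "cos_prod s a b (vec_abs s k) y = cos_prod s a b k y"
  unfolding cos_prod_def by (intro prod.cong) (auto simp: abs_if)

text \<open>The integer vectors that differ from \<open>k\<close> only in signs, for \<open>k\<close> with nonnegative entries.\<close>

definition sign_fibre :: "nat \<Rightarrow> (nat \<Rightarrow> int) \<Rightarrow> (nat \<Rightarrow> int) set" where
  "sign_fibre s k = {l \<in> int_vecs s. vec_abs s l = k}"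

lemma card_sign_fibre:
  assumes "k \<in> nat_vecs s"
  shows "finite (sign_fibre s k)" "card (sign_fibre s k) = 2 ^ num_nonzero s k"
proof -
  have nn: "k j \<ge> 0" if "j < s" for j using assms that by (auto simp: nat_vecs_def PiE_iff)
  have "vec_abs s l = k \<longleftrightarrow> (\<forall>j<s. l j = k j \<or> l j = - k j)" for l
  proof -
    have "vec_abs s l = k \<longleftrightarrow> vec_abs s l = vec_abs s k" using vec_abs_nat[OF assms] by simp
    also have "\<dots> \<longleftrightarrow> (\<forall>j<s. \<bar>l j\<bar> = \<bar>k j\<bar>)"
      using vec_abs_cong[of s l k] by (metis vec_abs_nth)
    also have "\<dots> \<longleftrightarrow> (\<forall>j<s. l j = k j \<or> l j = - k j)" by (simp add: abs_eq_iff)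
    finally show ?thesis .
  qed
  then have eq: "sign_fibre s k = (\<Pi>\<^sub>E j\<in>{..<s}. {k j, - k j})"
    by (simp add: sign_fibre_def int_vecs_def PiE_def Pi_def set_eq_iff conj_commute)
  show "finite (sign_fibre s k)" unfolding eq by (intro finite_PiE) auto
  have "card (sign_fibre s k) = (\<Prod>j<s. card {k j, - k j})"
    unfolding eq by (simp add: card_PiE)
  also have "\<dots> = (\<Prod>j<s. if k j \<noteq> 0 then 2 else 1)"
    by (intro prod.cong) auto
  also have "\<dots> = 2 ^ card {j \<in> {..<s}. k j \<noteq> 0}"
    by (simp add: prod.If_cases Int_def)
  also have "{j \<in> {..<s}. k j \<noteq> 0} = {j. j < s \<and> k j \<noteq> 0}" by auto
  finally show "card (sign_fibre s k) = 2 ^ num_nonzero s k" by (simp add: num_nonzero_def)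
qed

text \<open>A sum over \<open>\<int>\<^sup>s\<close> of a function of \<open>\<bar>k\<^sub>1\<bar>, \<dots>, \<bar>k\<^sub>s\<bar>\<close> is a sum over \<open>\<nat>\<^sup>s\<close> in which every
  \<open>k\<close> is counted with the size of its sign fibre.\<close>

lemma
  fixes F :: "(nat \<Rightarrow> int) \<Rightarrow> real"
  shows summable_on_sign_fold: "(\<lambda>k. 2 ^ num_nonzero s k * F k) summable_on nat_vecs s \<longleftrightarrow>
            (\<lambda>k. F (vec_abs s k)) summable_on int_vecs s" (is "?L \<longleftrightarrow> ?R")
    and infsum_sign_fold: "(\<lambda>k. F (vec_abs s k)) summable_on int_vecs s \<Longrightarrow>
            (\<Sum>\<^sub>\<infinity>k\<in>int_vecs s. F (vec_abs s k)) = (\<Sum>\<^sub>\<infinity>k\<in>nat_vecs s. 2 ^ num_nonzero s k * F k)"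
proof -
  let ?S = "Sigma (nat_vecs s) (sign_fibre s)"
  have bij: "bij_betw (\<lambda>l. (vec_abs s l, l)) (int_vecs s) ?S"
  proof (rule bij_betwI[where g = snd])
    have "vec_abs s l \<in> nat_vecs s" for l by (auto simp: vec_abs_def nat_vecs_def)
    then show "(\<lambda>l. (vec_abs s l, l)) \<in> int_vecs s \<rightarrow> ?S" by (auto simp: sign_fibre_def)
  qed (auto simp: sign_fibre_def)
  have inner: "((\<lambda>l. G k) has_sum 2 ^ num_nonzero s k * G k) (sign_fibre s k)"
    if "k \<in> nat_vecs s" for k and G :: "(nat \<Rightarrow> int) \<Rightarrow> real"
    using card_sign_fibre[OF that] by (intro has_sum_finiteI) simp_all
  have re: "(\<lambda>k. F (vec_abs s k)) summable_on int_vecs s \<longleftrightarrow> (\<lambda>(k, l). F k) summable_on ?S"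
    using summable_on_reindex_bij_betw[OF bij, of "\<lambda>(k, l). F k"] by simp
  have sum: "((\<lambda>k. 2 ^ num_nonzero s k * F k) has_sum (\<Sum>\<^sub>\<infinity>k\<in>int_vecs s. F (vec_abs s k))) (nat_vecs s)"
    if R: ?R
  proof -
    have "infsum (\<lambda>(k, l). F k) ?S = (\<Sum>\<^sub>\<infinity>k\<in>int_vecs s. F (vec_abs s k))"
      using infsum_reindex_bij_betw[OF bij, of "\<lambda>(k, l). F k"] by simp
    then have "((\<lambda>(k, l). F k) has_sum (\<Sum>\<^sub>\<infinity>k\<in>int_vecs s. F (vec_abs s k))) ?S"
      using R re by (metis has_sum_infsum)
    then show ?thesis
      by (rule has_sum_SigmaD) (use inner in auto)
  qed
  show "?L \<longleftrightarrow> ?R"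
  proof
    assume ?L
    then have "(\<lambda>k. \<bar>2 ^ num_nonzero s k * F k\<bar>) summable_on nat_vecs s"
      using summable_on_iff_abs_summable_on_real[THEN iffD1] by fastforce
    then have a: "(\<lambda>k. 2 ^ num_nonzero s k * \<bar>F k\<bar>) summable_on nat_vecs s"
      by (simp add: abs_mult)
    have "(\<lambda>(k, l). \<bar>F k\<bar>) summable_on ?S"
      by (rule summable_on_SigmaI[OF _ a]) (use inner[of _ "\<lambda>k. \<bar>F k\<bar>"] in auto)
    then have "(\<lambda>(k, l). F k) summable_on ?S"
      by - (rule abs_summable_summable, simp add: case_prod_unfold)
    then show ?R using re by simp
  qed (use sum in \<open>auto intro: has_sum_imp_summable\<close>)
  show "(\<Sum>\<^sub>\<infinity>k\<in>int_vecs s. F (vec_abs s k)) = (\<Sum>\<^sub>\<infinity>k\<in>nat_vecs s. 2 ^ num_nonzero s k * F k)" if ?R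
    using infsumI[OF sum[OF that]] by simp
qed

section \<open>From cosine products to characters\<close>

lemma prod_cos_eq_sum_cis:
  fixes x :: "nat \<Rightarrow> real"
  shows "2 ^ s * complex_of_real (\<Prod>j<s. cos (x j)) =
    (\<Sum>\<sigma>\<in>(\<Pi>\<^sub>E j\<in>{..<s}. {1, -1 :: int}). \<Prod>j<s. cis (of_int (\<sigma> j) * x j))"
proof -
  have "(\<Sum>\<sigma>\<in>(\<Pi>\<^sub>E j\<in>{..<s}. {1, -1 :: int}). \<Prod>j\<in>{..<s}. cis (of_int (\<sigma> j) * x j)) =
        (\<Prod>j<s. \<Sum>t\<in>{1, -1 :: int}. cis (of_int t * x j))"
    by (rule prod_sum_PiE[symmetric]) auto
  also have "\<dots> = (\<Prod>j<s. 2 * complex_of_real (cos (x j)))"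
    by (intro prod.cong) (auto simp: complex_eq_iff)
  finally show ?thesis by (simp add: prod.distrib)
qed

text \<open>For coefficients that are even in every coordinate, the cosine products in a sum over \<open>\<int>\<^sup>s\<close>
  may be replaced by exponentials: expanding the product of cosines gives an average over all sign
  flips of \<open>k\<close>, and each flip merely permutes the summands.\<close>

lemma infsum_cos_eq_cis:
  fixes c :: "(nat \<Rightarrow> int) \<Rightarrow> real" and \<theta> :: "nat \<Rightarrow> real"
  assumes c: "c summable_on int_vecs s"
    and even: "\<And>k. k \<in> int_vecs s \<Longrightarrow> c (vec_abs s k) = c k"
  shows "complex_of_real (\<Sum>\<^sub>\<infinity>k\<in>int_vecs s. c k * (\<Prod>j<s. cos (\<theta> j * of_int (k j)))) =
         (\<Sum>\<^sub>\<infinity>k\<in>int_vecs s. of_real (c k) * (\<Prod>j<s. cis (\<theta> j * of_int (k j))))"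
proof -
  let ?Z = "int_vecs s" and ?\<Sigma> = "\<Pi>\<^sub>E j\<in>{..<s}. {1, -1 :: int}"
  define e where "e k = (\<Prod>j<s. cis (\<theta> j * of_int (k j)))" for k :: "nat \<Rightarrow> int"
  define E where "E = (\<Sum>\<^sub>\<infinity>k\<in>?Z. of_real (c k) * e k)"
  define flip where "flip \<sigma> k = (\<lambda>j\<in>{..<s}. \<sigma> j * k j)" for \<sigma> k :: "nat \<Rightarrow> int"
  have cabs: "(\<lambda>k. \<bar>c k\<bar>) summable_on ?Z"
    using c summable_on_iff_abs_summable_on_real[THEN iffD1] by fastforce
  have norm_e: "norm (e k) = 1" for k by (simp add: e_def flip: prod_norm)
  have ce: "(\<lambda>k. of_real (c k) * e k) summable_on ?Z"
    by (rule abs_summable_summable) (simp add: norm_mult norm_e cabs)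
  \<comment> \<open>Flipping the signs of \<open>k\<close> permutes \<open>\<int>\<^sup>s\<close> and leaves \<open>c\<close> unchanged.\<close>
  have E: "((\<lambda>k. of_real (c k) * e (flip \<sigma> k)) has_sum E) ?Z" if \<sigma>: "\<sigma> \<in> ?\<Sigma>" for \<sigma>
  proof -
    have \<sigma>2: "\<sigma> j = 1 \<or> \<sigma> j = -1" if "j < s" for j using \<sigma> that by (auto simp: PiE_iff)
    have inv: "flip \<sigma> (flip \<sigma> k) = k" if "k \<in> ?Z" for k
    proof
      fix j show "flip \<sigma> (flip \<sigma> k) j = k j"
        using that \<sigma>2[of j] by (cases "j < s") (auto simp: flip_def int_vecs_def PiE_iff extensional_def)
    qed
    have "bij_betw (flip \<sigma>) ?Z ?Z"
      by (rule bij_betwI[where g = "flip \<sigma>"]) (auto simp: inv, auto simp: flip_def int_vecs_def)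
    moreover have "c (flip \<sigma> k) = c k" if "k \<in> ?Z" for k
    proof -
      have "vec_abs s (flip \<sigma> k) = vec_abs s k"
        using \<sigma>2 by (intro vec_abs_cong) (force simp: flip_def)
      moreover have "flip \<sigma> k \<in> ?Z" by (auto simp: flip_def int_vecs_def)
      ultimately show ?thesis using even[OF that] even[of "flip \<sigma> k"] by simp
    qed
    moreover have "((\<lambda>k. of_real (c k) * e k) has_sum E) ?Z"
      unfolding E_def using ce by (rule has_sum_infsum)
    ultimately show ?thesis
      using has_sum_reindex_bij_betw[of "flip \<sigma>" ?Z ?Z "\<lambda>k. of_real (c k) * e k" E]
      by (simp cong: has_sum_cong)
  qed
  have "((\<lambda>k. \<Sum>\<sigma>\<in>?\<Sigma>. of_real (c k) * e (flip \<sigma> k)) has_sum (\<Sum>\<sigma>\<in>?\<Sigma>. E)) ?Z"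
    by (rule has_sum_sum_finite) (auto intro!: finite_PiE E)
  also have "(\<Sum>\<sigma>\<in>?\<Sigma>. E) = 2 ^ s * E"
    by (simp add: card_PiE)
  also have "(\<lambda>k. \<Sum>\<sigma>\<in>?\<Sigma>. of_real (c k) * e (flip \<sigma> k)) =
      (\<lambda>k. 2 ^ s * complex_of_real (c k * (\<Prod>j<s. cos (\<theta> j * of_int (k j)))))"
  proof
    fix k
    have "(\<Sum>\<sigma>\<in>?\<Sigma>. e (flip \<sigma> k)) = 2 ^ s * complex_of_real (\<Prod>j<s. cos (\<theta> j * of_int (k j)))"
      unfolding prod_cos_eq_sum_cis e_def
      by (intro sum.cong prod.cong) (auto simp: flip_def mult_ac)
    then show "(\<Sum>\<sigma>\<in>?\<Sigma>. of_real (c k) * e (flip \<sigma> k)) =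
        2 ^ s * complex_of_real (c k * (\<Prod>j<s. cos (\<theta> j * of_int (k j))))"
      by (simp flip: sum_distrib_left)
  qed
  finally have "((\<lambda>k. complex_of_real (c k * (\<Prod>j<s. cos (\<theta> j * of_int (k j))))) has_sum E) ?Z"
    by (subst (asm) has_sum_cmult_right_iff) auto
  moreover have "(\<lambda>k. c k * (\<Prod>j<s. cos (\<theta> j * of_int (k j)))) summable_on ?Z"
  proof (rule abs_summable_summable, rule summable_on_comparison_test[OF cabs])
    fix k
    have "\<bar>\<Prod>j<s. cos (\<theta> j * of_int (k j))\<bar> \<le> 1"
      unfolding abs_prod by (intro prod_le_1) auto
    then show "norm (c k * (\<Prod>j<s. cos (\<theta> j * of_int (k j)))) \<le> \<bar>c k\<bar>"
      by (simp add: abs_mult mult_left_le)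
  qed auto
  ultimately show ?thesis
    unfolding E_def[symmetric] e_def[symmetric]
    by (blast intro: has_sum_unique has_sum_of_real has_sum_infsum)
qed

text \<open>The tent transformation doubles the frequency of half-period cosines, which turns them into
  functions of period one.\<close>

lemma cos_tent:
  "cos (pi * of_int k * tent (frac x)) = cos (2 * pi * x * of_int k)"
proof -
  have per: "cos (y + 2 * pi * of_int n) = cos y" for y and n :: int
    using cos_int_2pin[of n] sin_int_2pin[of n] by (simp add: cos_add)
  have "2 * pi * x * of_int k = 2 * pi * frac x * of_int k + 2 * pi * of_int (\<lfloor>x\<rfloor> * k)"
    by (simp add: frac_def algebra_simps)
  then have *: "cos (2 * pi * x * of_int k) = cos (2 * pi * frac x * of_int k)"
    using per by metis
  show ?thesis
  proof (cases "frac x \<le> 1/2")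
    case True
    then have "pi * of_int k * tent (frac x) = 2 * pi * frac x * of_int k"
      by (simp add: tent_def algebra_simps)
    then show ?thesis by (simp only: *)
  next
    case False
    then have "pi * of_int k * tent (frac x) = - (2 * pi * frac x * of_int k) + 2 * pi * of_int k"
      by (simp add: tent_def algebra_simps)
    with per[of "- (2 * pi * frac x * of_int k)" k] * show ?thesis by simp
  qed
qed

lemma cos_prod_tent_point:
  assumes "\<And>j. j < s \<Longrightarrow> a j < b j"
  shows "cos_prod s a b k (tent_point s a b N g n) =
    (\<Prod>j<s. cos (2 * pi * real n * real (g j) / real N * of_int (k j)))"
  unfolding cos_prod_def
proof (intro prod.cong refl)
  fix j assume "j \<in> {..<s}"
  then have j: "j < s" by simp
  have "(tent_point s a b N g n j - a j) / (b j - a j) = tent (frac (real n * real (g j) / real N))"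
    using j assms[OF j] by (simp add: tent_point_def scale_to_def)
  then show "cos (pi * real_of_int (k j) * ((tent_point s a b N g n j - a j) / (b j - a j))) =
      cos (2 * pi * real n * real (g j) / real N * of_int (k j))"
    using cos_tent[of "k j" "real n * real (g j) / real N"] by (simp add: mult.assoc)
qed

section \<open>Aliasing of rank-one lattice rules\<close>

lemma prod_cis: "finite J \<Longrightarrow> (\<Prod>j\<in>J. cis (x j)) = cis (\<Sum>j\<in>J. x j)"
  by (induction rule: finite_induct) (auto simp: cis_mult)

text \<open>The character \<open>exp (2 \<pi> \<i> k \<cdot> x)\<close> at the lattice point \<open>x = n g / N\<close>.\<close>

definition lattice_char :: "nat \<Rightarrow> nat \<Rightarrow> (nat \<Rightarrow> nat) \<Rightarrow> nat \<Rightarrow> (nat \<Rightarrow> int) \<Rightarrow> complex" where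
  "lattice_char s N g n k = (\<Prod>j<s. cis (2 * pi * real n * real (g j) / real N * of_int (k j)))"

lemma norm_lattice_char [simp]: "norm (lattice_char s N g n k) = 1"
  by (simp add: lattice_char_def flip: prod_norm)

lemma lattice_char_add:
  "lattice_char s N g n h = lattice_char s N g n k * lattice_char s N g n (vec_diff s h k)"
proof -
  have "cis (x * of_int (h j)) = cis (x * of_int (k j)) * cis (x * of_int (vec_diff s h k j))"
    if "j < s" for x j
    using that by (simp add: cis_mult flip: distrib_left)
  then show ?thesis
    unfolding lattice_char_def prod.distrib[symmetric] by (intro prod.cong refl) (simp only: lessThan_iff)
qed

text \<open>Character orthogonality: the sum over the lattice points is geometric with ratio
  \<open>exp (2 \<pi> \<i> h \<cdot> g / N)\<close>, an \<open>N\<close>-th root of unity that is \<open>1\<close> exactly on the dual lattice.\<close>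

lemma sum_lattice_char:
  assumes "N > 0" "h \<in> int_vecs s"
  shows "(\<Sum>n<N. lattice_char s N g n h) = (if h \<in> dual_lattice s N g then of_nat N else 0)"
proof -
  define M where "M = (\<Sum>j<s. h j * int (g j))"
  define w where "w = cis (2 * pi * of_int M / real N)"
  have ch: "lattice_char s N g n h = w ^ n" for n
  proof -
    have eq: "(\<Sum>j<s. 2 * pi * real n * real (g j) / real N * of_int (h j)) = real n * (2 * pi * of_int M / real N)"
      by (simp add: M_def sum_distrib_left sum_distrib_right sum_divide_distrib mult_ac)
    show ?thesis unfolding lattice_char_def prod_cis[OF finite_lessThan] eq w_def Complex.DeMoivre ..
  qed
  have dual: "h \<in> dual_lattice s N g \<longleftrightarrow> int N dvd M"
    using assms by (simp add: dual_lattice_def M_def cong_0_iff)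
  have w1: "w = 1 \<longleftrightarrow> int N dvd M"
  proof
    assume "w = 1"
    then obtain q :: int where "2 * pi * of_int M / real N = of_int (2 * q) * pi"
      unfolding w_def cis_conv_exp exp_eq_1 by auto
    then have "real_of_int M = of_int (q * int N)"
      using assms by (simp add: field_simps)
    then show "int N dvd M" by (metis dvd_triv_right of_int_eq_iff)
  next
    assume "int N dvd M"
    then obtain q where "M = int N * q" by auto
    then have "2 * pi * of_int M / real N = 2 * pi * of_int q" using assms by simp
    then show "w = 1" unfolding w_def by (metis Ints_of_int cis_multiple_2pi)
  qed
  have "w ^ N = cis (2 * pi * of_int M)"
    using assms by (simp add: w_def Complex.DeMoivre)
  then have wN: "w ^ N = 1" by simp
  show ?thesis
  proof (cases "w = 1")
    case True
    with w1 show ?thesis by (simp add: ch dual)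
  next
    case False
    then have "(\<Sum>n<N. w ^ n) = 0" by (simp add: geometric_sum wN)
    with False w1 show ?thesis by (simp add: ch dual)
  qed
qed

lemma dual_lattice_subset: "dual_lattice s N g \<subseteq> int_vecs s"
  by (auto simp: dual_lattice_def)

text \<open>The lattice rule applied to the product of two exponential series retains only those pairs of
  frequencies \<open>k\<close>, \<open>l\<close> for which \<open>h = k + l\<close> lies in the dual lattice.\<close>

lemma lattice_rule_aliasing:
  fixes c m :: "(nat \<Rightarrow> int) \<Rightarrow> real"
  assumes N: "N > 0"
    and cm: "(\<lambda>(h, k). \<bar>c k * m (vec_diff s h k)\<bar>) summable_on int_vecs s \<times> int_vecs s"
  shows "(\<Sum>n<N. (\<Sum>\<^sub>\<infinity>k\<in>int_vecs s. of_real (c k) * lattice_char s N g n k) *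
                 (\<Sum>\<^sub>\<infinity>k\<in>int_vecs s. of_real (m k) * lattice_char s N g n k)) / of_nat N =
         complex_of_real (\<Sum>\<^sub>\<infinity>h\<in>dual_lattice s N g. \<Sum>\<^sub>\<infinity>k\<in>int_vecs s. c k * m (vec_diff s h k))"
proof -
  let ?Z = "int_vecs s" and ?e = "lattice_char s N g" and ?D = "dual_lattice s N g"
  define W where "W h = (\<Sum>\<^sub>\<infinity>k\<in>?Z. c k * m (vec_diff s h k))" for h
  have cm': "(\<lambda>(h, k). c k * m (vec_diff s h k)) summable_on ?Z \<times> ?Z"
    by (rule abs_summable_summable) (use cm in \<open>simp add: case_prod_unfold\<close>)
  have Wh: "((\<lambda>k. of_real (c k * m (vec_diff s h k))) has_sum complex_of_real (W h)) ?Z" if "h \<in> ?Z" for h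
    unfolding W_def using summable_on_SigmaD1[OF cm' that] by (intro has_sum_of_real has_sum_infsum) simp
  have Wsum: "W summable_on ?Z"
    using summable_on_Sigma_banach[OF cm'] unfolding W_def[abs_def] .
  have prod: "((\<lambda>h. ?e n h * of_real (W h)) has_sum
      (\<Sum>\<^sub>\<infinity>k\<in>?Z. of_real (c k) * ?e n k) * (\<Sum>\<^sub>\<infinity>k\<in>?Z. of_real (m k) * ?e n k)) ?Z" for n
  proof -
    let ?t = "\<lambda>h k. ?e n h * of_real (c k * m (vec_diff s h k))"
    have t: "(\<lambda>(h, k). ?t h k) summable_on ?Z \<times> ?Z"
      by (rule abs_summable_summable) (use cm in \<open>simp add: case_prod_unfold norm_mult abs_mult\<close>)
    have bij: "bij_betw (\<lambda>h. vec_diff s h k) ?Z ?Z" if "k \<in> ?Z" for k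
    proof (rule bij_betwI[where g = "\<lambda>l. \<lambda>j\<in>{..<s}. l j + k j"])
      show "(\<lambda>l. \<lambda>j\<in>{..<s}. l j + k j) \<in> ?Z \<rightarrow> ?Z" by (auto simp: int_vecs_def)
    qed (auto simp: vec_diff_def int_vecs_def PiE_iff extensional_def restrict_def fun_eq_iff)
    have th: "((\<lambda>k. ?t h k) has_sum ?e n h * of_real (W h)) ?Z" if "h \<in> ?Z" for h
      by (intro has_sum_cmult_right Wh that)
    \<comment> \<open>For fixed \<open>k\<close> the second series is reindexed by \<open>l = h - k\<close>; then the sums are swapped.\<close>
    have "(\<Sum>\<^sub>\<infinity>k\<in>?Z. of_real (c k) * ?e n k) * (\<Sum>\<^sub>\<infinity>k\<in>?Z. of_real (m k) * ?e n k) =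
        (\<Sum>\<^sub>\<infinity>k\<in>?Z. of_real (c k) * ?e n k * (\<Sum>\<^sub>\<infinity>l\<in>?Z. of_real (m l) * ?e n l))"
      by (simp add: infsum_cmult_left')
    also have "\<dots> = (\<Sum>\<^sub>\<infinity>k\<in>?Z. \<Sum>\<^sub>\<infinity>h\<in>?Z. ?t h k)"
    proof (intro infsum_cong)
      fix k assume k: "k \<in> ?Z"
      have "of_real (c k) * ?e n k * (\<Sum>\<^sub>\<infinity>l\<in>?Z. of_real (m l) * ?e n l) =
          (\<Sum>\<^sub>\<infinity>l\<in>?Z. of_real (c k) * ?e n k * (of_real (m l) * ?e n l))"
        by (simp add: infsum_cmult_right')
      also have "\<dots> = (\<Sum>\<^sub>\<infinity>h\<in>?Z. of_real (c k) * ?e n k * (of_real (m (vec_diff s h k)) * ?e n (vec_diff s h k)))"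
        by (rule infsum_reindex_bij_betw[OF bij[OF k], symmetric])
      also have "\<dots> = (\<Sum>\<^sub>\<infinity>h\<in>?Z. ?t h k)"
        by (intro infsum_cong) (subst lattice_char_add[of s N g n _ k], simp)
      finally show "of_real (c k) * ?e n k * (\<Sum>\<^sub>\<infinity>l\<in>?Z. of_real (m l) * ?e n l) = (\<Sum>\<^sub>\<infinity>h\<in>?Z. ?t h k)" .
    qed
    also have "\<dots> = (\<Sum>\<^sub>\<infinity>h\<in>?Z. \<Sum>\<^sub>\<infinity>k\<in>?Z. ?t h k)"
      by (rule infsum_swap_banach[OF t, symmetric])
    also have "\<dots> = (\<Sum>\<^sub>\<infinity>h\<in>?Z. ?e n h * of_real (W h))"
      by (intro infsum_cong infsumI th)
    finally have eq: "(\<Sum>\<^sub>\<infinity>k\<in>?Z. of_real (c k) * ?e n k) * (\<Sum>\<^sub>\<infinity>k\<in>?Z. of_real (m k) * ?e n k) =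
        (\<Sum>\<^sub>\<infinity>h\<in>?Z. ?e n h * of_real (W h))" .
    have "(\<lambda>h. \<bar>W h\<bar>) summable_on ?Z"
      using Wsum summable_on_iff_abs_summable_on_real[THEN iffD1] by fastforce
    then have "(\<lambda>h. ?e n h * of_real (W h)) summable_on ?Z"
      by - (rule abs_summable_summable, simp add: norm_mult)
    then show ?thesis unfolding eq by (rule has_sum_infsum)
  qed
  have "((\<lambda>h. \<Sum>n<N. ?e n h * of_real (W h)) has_sum
      (\<Sum>n<N. (\<Sum>\<^sub>\<infinity>k\<in>?Z. of_real (c k) * ?e n k) * (\<Sum>\<^sub>\<infinity>k\<in>?Z. of_real (m k) * ?e n k))) ?Z" (is "(_ has_sum ?T) _")
    by (intro has_sum_sum_finite prod) auto
  moreover have "(\<Sum>n<N. ?e n h * of_real (W h)) = (if h \<in> ?D then of_nat N * of_real (W h) else 0)"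
    if "h \<in> ?Z" for h
    using sum_lattice_char[OF N that] by (simp flip: sum_distrib_right)
  ultimately have "((\<lambda>h. if h \<in> ?D then of_nat N * of_real (W h) else 0) has_sum ?T) ?Z"
    by (simp cong: has_sum_cong)
  then have T: "((\<lambda>h. of_nat N * of_real (W h)) has_sum ?T) ?D"
    by (subst (asm) has_sum_cong_neutral[where T = ?D and g = "\<lambda>h. of_nat N * of_real (W h)"])
       (use dual_lattice_subset in auto)
  have "((\<lambda>h. of_nat N * complex_of_real (W h)) has_sum of_nat N * of_real (\<Sum>\<^sub>\<infinity>h\<in>?D. W h)) ?D"
    by (intro has_sum_cmult_right has_sum_of_real has_sum_infsum summable_on_subset_banach[OF Wsum] dual_lattice_subset)
  with T have "?T = of_nat N * of_real (\<Sum>\<^sub>\<infinity>h\<in>?D. W h)" by (rule has_sum_unique)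
  then show ?thesis using N by (simp add: W_def)
qed

section \<open>The error of the lattice rule\<close>

lemma abs_cos_prod_le_1: "\<bar>cos_prod s a b k y\<bar> \<le> 1"
  unfolding cos_prod_def abs_prod by (intro prod_le_1) auto

lemma cos_prod_measurable:
  assumes "sets M = sets (borel_vec s)"
  shows "cos_prod s a b k \<in> borel_measurable M"
proof -
  have "cos_prod s a b k \<in> borel_measurable (borel_vec s)"
    unfolding cos_prod_def[abs_def] borel_vec_def by measurable
  then show ?thesis using measurable_cong_sets[OF assms refl] by blast
qed

text \<open>The coefficient of a cosine product when the expansion is taken over \<open>\<int>\<^sup>s\<close> instead of \<open>\<nat>\<^sup>s\<close>.
  The factor \<open>\<surd>2^\<bar>k\<bar>\<^sub>0\<close> of the expansion, divided by the \<open>2^\<bar>k\<bar>\<^sub>0\<close> sign patterns that share it,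
  is \<open>1 / \<surd>2^\<bar>k\<bar>\<^sub>0\<close>.\<close>

definition sym_coeff ::
    "nat \<Rightarrow> (nat \<Rightarrow> real) \<Rightarrow> (nat \<Rightarrow> real) \<Rightarrow> ((nat \<Rightarrow> real) \<Rightarrow> real) \<Rightarrow> (nat \<Rightarrow> int) \<Rightarrow> real" where
  "sym_coeff s a b f k = cos_coeff s a b f (vec_abs s k) / sqrt 2 ^ num_nonzero s k"

lemma sym_coeff_vec_abs [simp]: "sym_coeff s a b f (vec_abs s k) = sym_coeff s a b f k"
  by (simp add: sym_coeff_def)

lemma sqrt2_power_sq: "sqrt 2 ^ n * sqrt 2 ^ n = 2 ^ n"
  by (simp flip: power_mult_distrib)

lemma sym_coeff_norm:
  assumes "f \<in> cos_space s a b \<alpha> \<gamma>"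
  shows "(\<lambda>k. (sym_coeff s a b f k)\<^sup>2 / r s \<alpha> \<gamma> k) summable_on int_vecs s"
    and "sqrt (\<Sum>\<^sub>\<infinity>k\<in>int_vecs s. (sym_coeff s a b f k)\<^sup>2 / r s \<alpha> \<gamma> k) = cos_norm s a b \<alpha> \<gamma> f"
proof -
  define F where "F k = (cos_coeff s a b f k / sqrt 2 ^ num_nonzero s k)\<^sup>2 / r s \<alpha> \<gamma> k" for k
  have F: "F (vec_abs s k) = (sym_coeff s a b f k)\<^sup>2 / r s \<alpha> \<gamma> k" for k
    by (simp add: F_def sym_coeff_def)
  have "2 ^ num_nonzero s k * F k = \<bar>cos_coeff s a b f k\<bar>\<^sup>2 / r s \<alpha> \<gamma> k" for k
    by (simp add: F_def power2_eq_square sqrt2_power_sq)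
  note fold = summable_on_sign_fold[of s F, unfolded this F] infsum_sign_fold[of F s, unfolded this F]
  show S: "(\<lambda>k. (sym_coeff s a b f k)\<^sup>2 / r s \<alpha> \<gamma> k) summable_on int_vecs s"
    using assms fold(1) by (simp add: cos_space_def)
  show "sqrt (\<Sum>\<^sub>\<infinity>k\<in>int_vecs s. (sym_coeff s a b f k)\<^sup>2 / r s \<alpha> \<gamma> k) = cos_norm s a b \<alpha> \<gamma> f"
    using fold(2)[OF S] by (simp add: cos_norm_def)
qed

lemma summable_on_sym_coeff:
  assumes "f \<in> cos_space s a b \<alpha> \<gamma>" "\<alpha> > 1/2" "\<And>j. j < s \<Longrightarrow> \<gamma> j > 0"
  shows "sym_coeff s a b f summable_on int_vecs s"
proof -
  let ?c = "sym_coeff s a b f" and ?r = "r s \<alpha> \<gamma>"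
  have rpos: "?r k > 0" for k by (intro r_pos assms)
  have "(\<lambda>k. \<bar>?c k / sqrt (?r k) * sqrt (?r k)\<bar>) summable_on int_vecs s"
    by (rule Cauchy_Schwarz_infsum)
       (use sym_coeff_norm(1)[OF assms(1)] summable_on_r[OF assms(2,3), of s] less_imp_le[OF rpos] in \<open>auto simp: power_divide\<close>)
  moreover have "?c k / sqrt (?r k) * sqrt (?r k) = ?c k" for k using rpos[of k] by simp
  ultimately show ?thesis by - (rule abs_summable_summable, simp)
qed

lemma cos_expansion_eq:
  assumes "sym_coeff s a b f summable_on int_vecs s"
  shows "cos_expansion s a b f y = (\<Sum>\<^sub>\<infinity>k\<in>int_vecs s. sym_coeff s a b f k * cos_prod s a b k y)"
proof -
  define F where "F k = cos_coeff s a b f k / sqrt 2 ^ num_nonzero s k * cos_prod s a b k y" for k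
  have F: "F (vec_abs s k) = sym_coeff s a b f k * cos_prod s a b k y" for k
    by (simp add: F_def sym_coeff_def)
  have "2 ^ num_nonzero s k * F k = cos_coeff s a b f k * sqrt 2 ^ num_nonzero s k * cos_prod s a b k y" for k
    unfolding F_def sqrt2_power_sq[symmetric] by simp
  from infsum_sign_fold[of F s, unfolded F this] show ?thesis
    using summable_on_bounded_mult[OF assms abs_cos_prod_le_1] by (simp add: cos_expansion_def)
qed

lemma lattice_rule_error_bound:
  assumes ab: "\<And>j. j < s \<Longrightarrow> a j < b j" and N: "N > 0"
    and \<alpha>\<beta>: "\<alpha> > 1/2" "\<beta> - \<alpha> > 1/2"
    and \<gamma>: "\<And>j. j < s \<Longrightarrow> \<gamma> j > 0" and \<rho>: "\<And>j. j < s \<Longrightarrow> \<rho> j > 0"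
    and f: "f \<in> cos_space s a b \<alpha> \<gamma>"
    and \<mu>: "prob_space \<mu>" "sets \<mu> = sets (borel_vec s)"
    and decay: "\<And>k. k \<in> int_vecs s \<Longrightarrow> (LINT y|\<mu>. cos_prod s a b k y)\<^sup>2 \<le> r s \<beta> \<rho> k"
  shows "\<bar>lattice_kernel_integral s a b N g f \<mu> - (LINT y|\<mu>. cos_expansion s a b f y)\<bar>
         \<le> sqrt (\<Sum>\<^sub>\<infinity>h\<in>dual_lattice s N g - {zero_vec s}. r s \<alpha> \<gamma> h) *
            sqrt (\<Prod>i<s. conv_const \<alpha> \<beta> (\<gamma> i) (\<rho> i)) *
            cos_norm s a b \<alpha> \<gamma> f"
proof -
  interpret prob_space \<mu> by (rule \<mu>)
  let ?Z = "int_vecs s" and ?D = "dual_lattice s N g"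
  define c where "c = sym_coeff s a b f"
  define m where "m k = (LINT y|\<mu>. cos_prod s a b k y)" for k
  define W where "W h = (\<Sum>\<^sub>\<infinity>k\<in>?Z. c k * m (vec_diff s h k))" for h
  define S where "S h = (\<Sum>\<^sub>\<infinity>k\<in>?Z. \<bar>c k * m (vec_diff s h k)\<bar>)" for h
  have c_even: "c (vec_abs s k) = c k" for k by (simp add: c_def)
  have m_even: "m (vec_abs s k) = m k" for k by (simp add: m_def)
  have csum: "c summable_on ?Z" unfolding c_def by (rule summable_on_sym_coeff[OF f \<alpha>\<beta>(1) \<gamma>])
  have "\<bar>m k\<bar> \<le> sqrt (r s \<beta> \<rho> k)" if "k \<in> ?Z" for k
    using decay[OF that] by (intro real_le_rsqrt) (simp add: m_def)
  then have msum: "m summable_on ?Z"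
    by - (rule abs_summable_summable, rule summable_on_comparison_test[OF summable_on_sqrt_r[of \<beta> s \<rho>]], use \<alpha>\<beta> \<rho> in auto)
  note conv = convolution_bound[OF \<alpha>\<beta> \<gamma> \<rho>, where c = c and m = m and s = s, OF _ _ sym_coeff_norm(1)[OF f, folded c_def] decay[folded m_def], simplified]
  have Ssum: "S summable_on ?Z"
    using summable_on_Sigma_banach[OF conv(1)] unfolding S_def[abs_def] by simp
  have WS: "\<bar>W h\<bar> \<le> S h" if "h \<in> ?Z" for h
  proof -
    have "(\<lambda>k. norm (c k * m (vec_diff s h k))) summable_on ?Z"
      using summable_on_SigmaD1[OF conv(1) that] by simp
    from norm_infsum_bound[OF this] show ?thesis by (simp add: W_def S_def)
  qed
  have Wabs: "(\<lambda>h. \<bar>W h\<bar>) summable_on ?Z"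
    by (rule summable_on_comparison_test[OF Ssum]) (use WS in auto)
  have Wsum: "W summable_on ?Z" by (rule abs_summable_summable) (use Wabs in simp)
  have exp: "cos_expansion s a b f y = (\<Sum>\<^sub>\<infinity>k\<in>?Z. c k * cos_prod s a b k y)" for y
    using cos_expansion_eq csum unfolding c_def by blast
  have tp: "cos_prod s a b k (tent_point s a b N g n) =
      (\<Prod>j<s. cos (2 * pi * real n * real (g j) / real N * of_int (k j)))" for k n
    by (rule cos_prod_tent_point) (rule ab)
  have "complex_of_real (lattice_kernel_integral s a b N g f \<mu>) =
      (\<Sum>n<N. (\<Sum>\<^sub>\<infinity>k\<in>?Z. of_real (c k) * lattice_char s N g n k) *
              (\<Sum>\<^sub>\<infinity>k\<in>?Z. of_real (m k) * lattice_char s N g n k)) / of_nat N"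
  proof -
    have "complex_of_real (cos_expansion s a b f (tent_point s a b N g n)) =
        (\<Sum>\<^sub>\<infinity>k\<in>?Z. of_real (c k) * lattice_char s N g n k)" for n
      unfolding exp tp lattice_char_def
      by (rule infsum_cos_eq_cis[OF csum c_even])
    moreover have "complex_of_real (kernel_integral s a b \<mu> (tent_point s a b N g n)) =
        (\<Sum>\<^sub>\<infinity>k\<in>?Z. of_real (m k) * lattice_char s N g n k)" for n
    proof -
      have "kernel_integral s a b \<mu> (tent_point s a b N g n) =
          (\<Sum>\<^sub>\<infinity>k\<in>?Z. m k * (\<Prod>j<s. cos (2 * pi * real n * real (g j) / real N * of_int (k j))))"
        unfolding kernel_integral_def tp m_def by (simp only: mult.commute)
      then show ?thesis
        unfolding lattice_char_def by (simp only: infsum_cos_eq_cis[OF msum m_even])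
    qed
    ultimately show ?thesis by (simp add: lattice_kernel_integral_def)
  qed
  also have "\<dots> = complex_of_real (\<Sum>\<^sub>\<infinity>h\<in>?D. W h)"
    unfolding W_def by (rule lattice_rule_aliasing[OF N conv(1)])
  finally have lattice: "lattice_kernel_integral s a b N g f \<mu> = (\<Sum>\<^sub>\<infinity>h\<in>?D. W h)"
    by (simp only: of_real_eq_iff)
  have integral: "(LINT y|\<mu>. cos_expansion s a b f y) = W (zero_vec s)"
  proof -
    have "(LINT y|\<mu>. cos_expansion s a b f y) = (\<Sum>\<^sub>\<infinity>k\<in>?Z. (LINT y|\<mu>. c k * cos_prod s a b k y))"
      unfolding exp
    proof (rule integral_infsum_bounded[where B = "\<lambda>k. \<bar>c k\<bar>"])
      show "finite_measure \<mu>" by unfold_locales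
      show "countable ?Z" unfolding int_vecs_def by (intro countable_PiE) auto
      show "(\<lambda>k. \<bar>c k\<bar>) summable_on ?Z"
        using csum summable_on_iff_abs_summable_on_real[THEN iffD1] by fastforce
    qed (use cos_prod_measurable[OF \<mu>(2)] abs_cos_prod_le_1 in \<open>auto simp: abs_mult intro!: mult_left_le\<close>)
    also have "\<dots> = W (zero_vec s)"
      unfolding W_def
    proof (rule infsum_cong)
      fix k
      \<comment> \<open>\<open>m\<close> is even, so \<open>m (0 - k) = m k\<close>.\<close>
      have "vec_abs s (vec_diff s (zero_vec s) k) = vec_abs s k"
        by (rule vec_abs_cong) (simp add: zero_vec_def)
      then have "m (vec_diff s (zero_vec s) k) = m k" by (metis m_even)
      then show "(LINT y|\<mu>. c k * cos_prod s a b k y) = c k * m (vec_diff s (zero_vec s) k)"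
        by (simp add: m_def)
    qed
    finally show ?thesis .
  qed
  have zero: "zero_vec s \<in> ?D"
    by (auto simp: dual_lattice_def zero_vec_def int_vecs_def)
  note sub = summable_on_subset_banach[OF _ dual_lattice_subset]
  have sub': "?D - {zero_vec s} \<subseteq> ?Z" using dual_lattice_subset by blast
  have "(\<Sum>\<^sub>\<infinity>h\<in>?D - {zero_vec s}. W h) = (\<Sum>\<^sub>\<infinity>h\<in>?D. W h) - (\<Sum>\<^sub>\<infinity>h\<in>{zero_vec s}. W h)"
    by (rule infsum_Diff) (use sub[OF Wsum] zero in auto)
  then have "\<bar>lattice_kernel_integral s a b N g f \<mu> - (LINT y|\<mu>. cos_expansion s a b f y)\<bar>
      = \<bar>\<Sum>\<^sub>\<infinity>h\<in>?D - {zero_vec s}. W h\<bar>"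
    by (simp add: lattice integral)
  also have "\<dots> \<le> (\<Sum>\<^sub>\<infinity>h\<in>?D - {zero_vec s}. \<bar>W h\<bar>)"
    using norm_infsum_bound[of W "?D - {zero_vec s}"] summable_on_subset_banach[OF Wabs sub'] by simp
  also have "\<dots> \<le> (\<Sum>\<^sub>\<infinity>h\<in>?D - {zero_vec s}. S h)"
    by (intro infsum_mono summable_on_subset_banach[OF Wabs sub'] summable_on_subset_banach[OF Ssum sub'])
       (use WS sub' in auto)
  also have "\<dots> \<le> sqrt (\<Sum>\<^sub>\<infinity>h\<in>?D - {zero_vec s}. r s \<alpha> \<gamma> h) *
            sqrt (\<Prod>i<s. conv_const \<alpha> \<beta> (\<gamma> i) (\<rho> i)) * cos_norm s a b \<alpha> \<gamma> f"
    using conv(2)[OF sub'] unfolding S_def sym_coeff_norm(2)[OF f, folded c_def] .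
  finally show ?thesis .
qed

theorem theorem2p2:
  "\<exists>C :: real \<Rightarrow> real \<Rightarrow> real \<Rightarrow> real \<Rightarrow> real.
     \<forall>(s :: nat) (a :: nat \<Rightarrow> real) (b :: nat \<Rightarrow> real) (N :: nat) (g :: nat \<Rightarrow> nat)
       (\<alpha> :: real) (\<gamma> :: nat \<Rightarrow> real) (f :: (nat \<Rightarrow> real) \<Rightarrow> real)
       (\<mu> :: (nat \<Rightarrow> real) measure) (\<beta> :: real) (\<rho> :: nat \<Rightarrow> real).
       s \<ge> 1 \<longrightarrow>
       (\<forall>j<s. a j < b j) \<longrightarrow>
       N \<ge> 2 \<longrightarrow>
       (\<forall>j<s. g j \<in> {1..N - 1}) \<longrightarrow>
       \<alpha> > 1 / 2 \<longrightarrow>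
       (\<forall>j<s. \<gamma> j > 0) \<longrightarrow>
       f \<in> cos_space s a b \<alpha> \<gamma> \<longrightarrow>
       prob_space \<mu> \<longrightarrow> sets \<mu> = sets (borel_vec s) \<longrightarrow>
       \<beta> > real s \<longrightarrow>
       (\<forall>j<s. \<rho> j > 0) \<longrightarrow>
       (\<forall>k\<in>int_vecs s. (LINT y|\<mu>. cos_prod s a b k y)\<^sup>2 \<le> r s \<beta> \<rho> k) \<longrightarrow>
       \<beta> - \<alpha> > 1 / 2 \<longrightarrow>
       \<bar>lattice_kernel_integral s a b N g f \<mu> - (LINT y|\<mu>. cos_expansion s a b f y)\<bar>
         \<le> sqrt (\<Sum>\<^sub>\<infinity>h\<in>dual_lattice s N g - {zero_vec s}. r s \<alpha> \<gamma> h) *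
            sqrt (\<Prod>i<s. C \<alpha> \<beta> (\<gamma> i) (\<rho> i)) *
            cos_norm s a b \<alpha> \<gamma> f"
  by (intro exI[of _ conv_const] allI impI lattice_rule_error_bound) auto

end
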